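(* In the rank $2$ setting described in the context (finite or infinite case alike), cluster variables are determined by their denominators in the Laurent expansions with respect to the cluster $\{y_1,y_2\}$ uniquely up to a multiple from $\mathbb{P}$ (that is, if $\delta(m)=\delta(m')$ then $y_m/y_{m'}\in\mathbb{P}$), and the set of denominators $\{\delta(m): m\in\mathbb{Z}\}$ equals $\{-\alpha_1,-\alpha_2\}\cup\Phi_+$. More precisely: (i) In the infinite case ($bc\ge 4$), for all $m\geq 0$, $$\delta(m+3)=w_1(m)\alpha_{\langle m+1\rangle},\qquad \delta(-m)=w_2(m)\alpha_{\langle m+2\rangle}.$$ In particular, all $y_m$, $m\in\mathbb{Z}$, have different denominators $y_1^{d_1(m)}y_2^{d_2(m)}$. (ii) In the finite case ($bc\le 3$), $\delta(m+3)=w_1(m)\alpha_{\langle m+1\rangle}$ for $0\le m<h$, and $\delta(m+h+2)=\delta(m)$ for all $m\in\mathbb{Z}$, so the denominators $y_1^{d_1(m)}y_2^{d_2(m)}$ are periodic with period $h+2$. Moreover, $y_{m+h+2}/y_m\in\mathbb{P}$ for all $m\in\mathbb{Z}$.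
   Context: Rank 2 cluster variables. Let $\mathbb{P}$ be a torsion-free abelian group written multiplicatively, let $b,c$ be integers that are either both positive or both equal to $0$, and let $(q_m)_{m\in\mathbb{Z}},(r_m)_{m\in\mathbb{Z}}$ be elements of $\mathbb{P}$ such that for all $m\in\mathbb{Z}$: $q_{m-1}q_{m+1}r_m^{c}=r_{m-1}r_{m+1}$ if $m$ is odd, and $q_{m-1}q_{m+1}r_m^{b}=r_{m-1}r_{m+1}$ if $m$ is even. Let $\mathcal{F}$ be the field of rational functions in two variables $y_1,y_2$ with coefficients in $\mathbb{Z}\mathbb{P}$. The cluster variables $y_m\in\mathcal{F}$, $m\in\mathbb{Z}$, are defined by the exchange relations: $y_{m-1}y_{m+1}=q_my_m^{b}+r_m$ for $m$ odd, and $y_{m-1}y_{m+1}=q_my_m^{c}+r_m$ for $m$ even. The clusters are the pairs $\{y_m,y_{m+1}\}$. (Up to interchanging the two monomials at every exchange, every cluster algebra of rank $2$ is of this form.) Each $y_m$ is a Laurent polynomial in $y_1,y_2$ with coefficients in $\mathbb{Z}\mathbb{P}$; write $y_m=\dfrac{N_m(y_1,y_2)}{y_1^{d_1(m)}y_2^{d_2(m)}}$ with $N_m\in\mathbb{Z}\mathbb{P}[y_1,y_2]$ a polynomial not divisible by $y_1$ or $y_2$ (the integers $d_i(m)$ may be negative). Root system. Let $Q\cong\mathbb{Z}^2$ be a lattice with basis $\{\alpha_1,\alpha_2\}$ (simple roots); put $\delta(m)=d_1(m)\alpha_1+d_2(m)\alpha_2\in Q$ (so $\delta(1)=-\alpha_1$,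 $\delta(2)=-\alpha_2$). The Weyl group $W$ is the group of linear transformations of $Q$ generated by $s_1,s_2$, which act in the basis of simple roots by the matrices $s_1=\begin{pmatrix}-1&b\\0&1\end{pmatrix}$, $s_2=\begin{pmatrix}1&0\\c&-1\end{pmatrix}$ acting on column vectors (i.e. $s_1\alpha_1=-\alpha_1$, $s_1\alpha_2=b\alpha_1+\alpha_2$, $s_2\alpha_1=\alpha_1+c\alpha_2$, $s_2\alpha_2=-\alpha_2$). For $m\in\mathbb{Z}$, $\langle m\rangle$ is the element of $\{1,2\}$ congruent to $m$ modulo $2$. For $m\ge0$, $w_1(m)=s_1s_2s_1\cdots s_{\langle m\rangle}$ and $w_2(m)=s_2s_1s_2\cdots s_{\langle m+1\rangle}$, alternating products of length $m$. $\Phi$ is the set of real roots, i.e. vectors of $Q$ that are $W$-conjugate to a simple root, and $\Phi_+=\{d_1\alpha_1+d_2\alpha_2\in\Phi: d_1,d_2\ge0\}$. The Coxeter number $h$ is the order of $s_1s_2$ in $W$: $h=2,3,4,6$ for $bc=0,1,2,3$ respectively, and $h=\infty$ for $bc\geq4$. $W$ is finite iff $bc\le3$ (the finite case); otherwise one is in the infinite case. *)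

theory Defs
  imports
    "HOL-Algebra.Multiplicative_Group"
    "HOL-Algebra.Bij"
    "HOL-Library.Product_Plus"
    "HOL-Computational_Algebra.Polynomial_Factorial"
begin

class torsion_free_ab_group_mult = comm_monoid_mult + inverse +
  assumes grp_left_inverse: "inverse x * x = 1"
    and grp_divide_inverse: "x / y = x * inverse y"
    and grp_torsion_free: "0 < n \<Longrightarrow> x ^ n = 1 \<Longrightarrow> x = 1"
begin

lemma grp_right_inverse: "x * inverse x = 1"
  using grp_left_inverse by (simp add: mult.commute)

lemma grp_cancel_left: "inverse x * (x * y) = y"
  by (metis grp_left_inverse mult.assoc mult_1_left)

lemma grp_cancel_right: "x * (inverse x * y) = y"
  by (metis grp_right_inverse mult.assoc mult_1_left)

lemma grp_inverse_unique: "x * y = 1 \<Longrightarrow> inverse x = y"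
  by (metis grp_cancel_left mult_1_right)

lemma grp_inverse_inverse: "inverse (inverse x) = x"
  by (rule grp_inverse_unique) (rule grp_left_inverse)

lemma grp_inverse_mult: "inverse (x * y) = inverse x * inverse y"
  by (rule grp_inverse_unique)
    (metis grp_right_inverse grp_cancel_right mult.assoc mult.commute)

lemma grp_inverse_power: "inverse (x ^ n) = inverse x ^ n"
  by (rule grp_inverse_unique)
    (metis grp_right_inverse power_mult_distrib power_one)

text \<open>Every torsion-free abelian group admits a total order compatible with multiplication; here
  as its cone \<open>M\<close> of elements \<open>\<ge> 1\<close>. It is used only to show that the group ring is a domain.\<close>

definition pointed_cone :: "'a set \<Rightarrow> bool" where
  "pointed_cone M \<longleftrightarrow> 1 \<in> M \<and> (\<forall>x\<in>M. \<forall>y\<in>M. x * y \<in> M) \<and> (\<forall>x\<in>M. inverse x \<in> M \<longrightarrow> x = 1)"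

lemma pointed_cone_power: "pointed_cone M \<Longrightarrow> x \<in> M \<Longrightarrow> x ^ n \<in> M"
  by (induction n) (auto simp: pointed_cone_def)

lemma maximal_cone_step:
  assumes M: "pointed_cone M" and max: "\<And>N. pointed_cone N \<Longrightarrow> M \<subseteq> N \<Longrightarrow> N = M"
    and x: "x \<notin> M"
  shows "\<exists>n>0. inverse (x ^ n) \<in> M"
proof (rule ccontr)
  assume neg: "\<not> (\<exists>n>0. inverse (x ^ n) \<in> M)"
  define N where "N = {m * x ^ n | m n. m \<in> M}"
  have "pointed_cone N"
    unfolding pointed_cone_def
  proof (intro conjI ballI impI)
    show "1 \<in> N"
      using M unfolding N_def pointed_cone_def by (auto intro!: exI[of _ 1] exI[of _ 0])
  next
    fix u v assume "u \<in> N" "v \<in> N"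
    then obtain m n m' n' where uv: "u = m * x ^ n" "v = m' * x ^ n'" "m \<in> M" "m' \<in> M"
      unfolding N_def by blast
    have "u * v = (m * m') * x ^ (n + n')"
      by (simp add: uv power_add mult.assoc mult.left_commute)
    then show "u * v \<in> N"
      using M uv unfolding N_def pointed_cone_def by blast
  next
    fix u assume "u \<in> N" "inverse u \<in> N"
    then obtain m n m' n' where uv: "u = m * x ^ n" "inverse u = m' * x ^ n'" "m \<in> M" "m' \<in> M"
      unfolding N_def by blast
    have mm: "m * m' \<in> M" using M uv unfolding pointed_cone_def by blast
    have "(m * m') * x ^ (n + n') = (m * x ^ n) * (m' * x ^ n')"
      by (simp add: power_add mult.assoc mult.left_commute)
    also have "\<dots> = u * inverse u"
      by (simp only: uv(2) flip: uv(1))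
    finally have eq: "x ^ (n + n') * (m * m') = 1"
      by (simp add: grp_right_inverse mult.commute)
    then have "inverse (x ^ (n + n')) \<in> M"
      using mm grp_inverse_unique by metis
    then have "n + n' = 0" using neg by auto
    then have "n = 0" "n' = 0" by auto
    then have "u = m" "inverse u = m'" using uv by auto
    then show "u = 1" using M uv unfolding pointed_cone_def by blast
  qed
  moreover have "M \<subseteq> N"
    unfolding N_def by (auto intro!: exI[of _ 0])
  ultimately have "N = M" by (rule max)
  moreover have "x \<in> N"
    using M unfolding N_def pointed_cone_def by (metis (mono_tags, lifting) mem_Collect_eq mult_1_left power_one_right)
  ultimately show False using x by blast
qed

lemma total_cone_exists:
  "\<exists>M. pointed_cone M \<and> (\<forall>x. x \<in> M \<or> inverse x \<in> M)"
proof -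
  have "\<exists>M\<in>Collect pointed_cone. \<forall>X\<in>Collect pointed_cone. M \<subseteq> X \<longrightarrow> X = M"
  proof (rule subset_Zorn_nonempty)
    have "pointed_cone {1}" by (auto simp: pointed_cone_def)
    then show "Collect pointed_cone \<noteq> {}" by blast
  next
    fix C assume ne: "C \<noteq> {}" and ch: "subset.chain (Collect pointed_cone) C"
    have sub: "\<And>M. M \<in> C \<Longrightarrow> pointed_cone M"
      using ch unfolding subset.chain_def by auto
    have common: "\<exists>M\<in>C. x \<in> M \<and> y \<in> M" if xy: "x \<in> \<Union>C" "y \<in> \<Union>C" for x y
    proof -
      obtain A B where "A \<in> C" "x \<in> A" "B \<in> C" "y \<in> B" using xy by blast
      moreover from this have "A \<subseteq> B \<or> B \<subseteq> A"
        using ch unfolding subset.chain_def by blast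
      ultimately show ?thesis by blast
    qed
    have "pointed_cone (\<Union>C)"
      unfolding pointed_cone_def
    proof (intro conjI ballI impI)
      show "1 \<in> \<Union>C" using ne sub unfolding pointed_cone_def by blast
    next
      fix x y assume "x \<in> \<Union>C" "y \<in> \<Union>C"
      then obtain M where "M \<in> C" "x \<in> M" "y \<in> M" using common by blast
      then show "x * y \<in> \<Union>C" using sub unfolding pointed_cone_def by blast
    next
      fix x assume "x \<in> \<Union>C" "inverse x \<in> \<Union>C"
      then obtain M where "M \<in> C" "x \<in> M" "inverse x \<in> M" using common by blast
      then show "x = 1" using sub unfolding pointed_cone_def by blast
    qed
    then show "\<Union>C \<in> Collect pointed_cone" by simp
  qed
  then obtain M where M: "pointed_cone M" and max: "\<And>N. pointed_cone N \<Longrightarrow> M \<subseteq> N \<Longrightarrow> N = M"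
    by blast
  have "x \<in> M \<or> inverse x \<in> M" for x
  proof (rule ccontr)
    assume "\<not> (x \<in> M \<or> inverse x \<in> M)"
    then have nx: "x \<notin> M" and ny: "inverse x \<notin> M" by auto
    obtain n where n: "n > 0" "inverse (x ^ n) \<in> M"
      using maximal_cone_step[OF M max nx] by blast
    obtain k where k: "k > 0" "inverse (inverse x ^ k) \<in> M"
      using maximal_cone_step[OF M max ny] by blast
    have "x ^ k \<in> M"
      using k by (simp add: grp_inverse_power[symmetric] grp_inverse_inverse)
    then have "(x ^ k) ^ n \<in> M" by (rule pointed_cone_power[OF M])
    then have 1: "x ^ (n * k) \<in> M" by (simp add: power_mult[symmetric] ab_semigroup_mult_class.mult.commute)
    have "inverse (x ^ n) ^ k \<in> M" by (rule pointed_cone_power[OF M n(2)])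
    then have "inverse (x ^ (n * k)) \<in> M"
      by (simp add: grp_inverse_power power_mult)
    then have "x ^ (n * k) = 1" using 1 M unfolding pointed_cone_def by blast
    then have "x = 1" using grp_torsion_free[of "n * k" x] n k by simp
    then show False using nx M unfolding pointed_cone_def by blast
  qed
  then show ?thesis using M by blast
qed

lemma cone_maximum:
  assumes M: "pointed_cone M" and tot: "\<And>x. x \<in> M \<or> inverse x \<in> M"
    and "finite A" "A \<noteq> {}"
  shows "\<exists>a\<in>A. \<forall>x\<in>A. inverse x * a \<in> M"
  using assms(3,4)
proof (induction A rule: finite_ne_induct)
  case (singleton x)
  then show ?case using M by (auto simp: pointed_cone_def grp_left_inverse)
next
  case (insert z A)
  then obtain a where a: "a \<in> A" "\<And>x. x \<in> A \<Longrightarrow> inverse x * a \<in> M" by blast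
  show ?case
  proof (cases "inverse z * a \<in> M")
    case True
    then show ?thesis using a by blast
  next
    case False
    then have "inverse (inverse z * a) \<in> M" using tot by blast
    then have za: "inverse a * z \<in> M"
      by (simp add: grp_inverse_mult grp_inverse_inverse mult.commute)
    have "inverse x * z \<in> M" if "x \<in> A" for x
    proof -
      have "(inverse x * a) * (inverse a * z) \<in> M"
        using a(2)[OF that] za M unfolding pointed_cone_def by blast
      then show ?thesis by (simp add: mult.assoc grp_cancel_right)
    qed
    moreover have "inverse z * z \<in> M"
      using M by (simp add: pointed_cone_def grp_left_inverse)
    ultimately show ?thesis by blast
  qed
qed

end

text \<open>HOL-Library's \<open>Poly_Mapping\<close> is not used: it is a domain only over linearly
  ordered monoids, which is not part of the structure of a torsion-free group.\<close>

typedef 'p group_ring = "{f :: 'p \<Rightarrow> int. finite {x. f x \<noteq> 0}}"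
  morphisms gr_coeff Abs_group_ring
  by (rule exI[of _ "\<lambda>_. 0"]) simp

setup_lifting type_definition_group_ring

lemma gr_eqI: "(\<And>x. gr_coeff f x = gr_coeff g x) \<Longrightarrow> f = g"
  by (simp add: gr_coeff_inject[symmetric] ext)

definition gr_supp :: "'p group_ring \<Rightarrow> 'p set" where
  "gr_supp f = {x. gr_coeff f x \<noteq> 0}"

lemma gr_supp_iff: "x \<in> gr_supp f \<longleftrightarrow> gr_coeff f x \<noteq> 0"
  by (simp add: gr_supp_def)

lemma finite_gr_supp [simp]: "finite (gr_supp f)"
  using gr_coeff[of f] by (simp add: gr_supp_def)

instantiation group_ring :: (type) ab_group_add
begin

lift_definition zero_group_ring :: "'a group_ring" is "\<lambda>_. 0" by simp

lift_definition plus_group_ring :: "'a group_ring \<Rightarrow> 'a group_ring \<Rightarrow> 'a group_ring"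
  is "\<lambda>f g x. f x + g x"
proof -
  fix f g :: "'a \<Rightarrow> int"
  assume "finite {x. f x \<noteq> 0}" "finite {x. g x \<noteq> 0}"
  then have "finite ({x. f x \<noteq> 0} \<union> {x. g x \<noteq> 0})" by simp
  then show "finite {x. f x + g x \<noteq> 0}" by (rule rev_finite_subset) auto
qed

lift_definition uminus_group_ring :: "'a group_ring \<Rightarrow> 'a group_ring"
  is "\<lambda>f x. - f x" by simp

lift_definition minus_group_ring :: "'a group_ring \<Rightarrow> 'a group_ring \<Rightarrow> 'a group_ring"
  is "\<lambda>f g x. f x - g x"
proof -
  fix f g :: "'a \<Rightarrow> int"
  assume "finite {x. f x \<noteq> 0}" "finite {x. g x \<noteq> 0}"
  then have "finite ({x. f x \<noteq> 0} \<union> {x. g x \<noteq> 0})" by simp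
  then show "finite {x. f x - g x \<noteq> 0}" by (rule rev_finite_subset) auto
qed

instance by standard (transfer, simp add: fun_eq_iff algebra_simps)+

end

lift_definition of_grp :: "'p \<Rightarrow> 'p group_ring" is "\<lambda>p x. if x = p then 1 else 0"
  by simp

instantiation group_ring :: (torsion_free_ab_group_mult) idom
begin

definition one_group_ring :: "'a group_ring" where
  "one_group_ring = of_grp 1"

lift_definition times_group_ring :: "'a group_ring \<Rightarrow> 'a group_ring \<Rightarrow> 'a group_ring"
  is "\<lambda>f g z. \<Sum>x | f x \<noteq> 0. f x * g (inverse x * z)"
proof -
  fix f g :: "'a \<Rightarrow> int"
  assume fin: "finite {x. f x \<noteq> 0}" "finite {x. g x \<noteq> 0}"
  have "{z. (\<Sum>x | f x \<noteq> 0. f x * g (inverse x * z)) \<noteq> 0}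
      \<subseteq> (\<lambda>(x, y). x * y) ` ({x. f x \<noteq> 0} \<times> {x. g x \<noteq> 0})"
  proof
    fix z assume "z \<in> {z. (\<Sum>x | f x \<noteq> 0. f x * g (inverse x * z)) \<noteq> 0}"
    then have "(\<Sum>x | f x \<noteq> 0. f x * g (inverse x * z)) \<noteq> 0" by simp
    then obtain x where "f x * g (inverse x * z) \<noteq> 0"
      by (rule sum.not_neutral_contains_not_neutral)
    then show "z \<in> (\<lambda>(x, y). x * y) ` ({x. f x \<noteq> 0} \<times> {x. g x \<noteq> 0})"
      by (intro image_eqI[of _ _ "(x, inverse x * z)"]) (auto simp: grp_cancel_right)
  qed
  then show "finite {z. (\<Sum>x | f x \<noteq> 0. f x * g (inverse x * z)) \<noteq> 0}"
    by (rule finite_subset) (simp add: fin)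
qed

lemma gr_coeff_times:
  fixes f g :: "'a group_ring"
  shows "gr_coeff (f * g) z = (\<Sum>x\<in>gr_supp f. gr_coeff f x * gr_coeff g (inverse x * z))"
  unfolding gr_supp_def by transfer simp

lemma group_ring_mult_comm: "f * g = g * (f :: 'a group_ring)"
proof (rule gr_eqI)
  fix z
  have *: "gr_coeff (f * g) z = (\<Sum>x | x \<in> gr_supp f \<and> inverse x * z \<in> gr_supp g.
      gr_coeff f x * gr_coeff g (inverse x * z))" for f g :: "'a group_ring"
    unfolding gr_coeff_times by (rule sum.mono_neutral_right) (auto simp: gr_supp_iff)
  have inv: "inverse (inverse x * z) * z = x" for x :: 'a
    by (simp add: grp_inverse_mult grp_inverse_inverse mult.assoc grp_left_inverse)
  show "gr_coeff (f * g) z = gr_coeff (g * f) z"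
    unfolding *
    by (rule sum.reindex_bij_witness[of _ "\<lambda>x. inverse x * z" "\<lambda>x. inverse x * z"])
      (auto simp: inv)
qed

lemma group_ring_left_comm: "f * (h * g) = h * (f * g)" for f g h :: "'a group_ring"
proof (rule gr_eqI)
  fix z
  have 1: "gr_coeff (f * (h * g)) z = (\<Sum>x\<in>gr_supp f. \<Sum>w\<in>gr_supp h.
      gr_coeff f x * (gr_coeff h w * gr_coeff g (inverse w * (inverse x * z))))"
    for f g h :: "'a group_ring"
    by (simp add: gr_coeff_times sum_distrib_left)
  show "gr_coeff (f * (h * g)) z = gr_coeff (h * (f * g)) z"
    unfolding 1 by (subst sum.swap) (simp add: mult.left_commute)
qed

lemma group_ring_distrib_right: "(f + g) * h = f * h + g * (h :: 'a group_ring)"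
proof (rule gr_eqI)
  fix z
  have add: "gr_coeff (u + v) x = gr_coeff u x + gr_coeff v x" for u v :: "'a group_ring" and x
    by transfer simp
  have ext: "gr_coeff (u * h) z
      = (\<Sum>x\<in>gr_supp f \<union> gr_supp g. gr_coeff u x * gr_coeff h (inverse x * z))"
    if "gr_supp u \<subseteq> gr_supp f \<union> gr_supp g" for u
    unfolding gr_coeff_times
    by (rule sum.mono_neutral_left) (use that in \<open>auto simp: gr_supp_iff\<close>)
  have "gr_supp (f + g) \<subseteq> gr_supp f \<union> gr_supp g"
    by (auto simp: gr_supp_def add)
  then show "gr_coeff ((f + g) * h) z = gr_coeff (f * h + g * h) z"
    by (simp add: ext add sum.distrib[symmetric] distrib_right)
qed

lemma group_ring_zero_times: "0 * f = (0 :: 'a group_ring)"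
  by (rule gr_eqI) (simp add: gr_coeff_times gr_supp_def zero_group_ring.rep_eq)

instance
proof
  fix f g h :: "'a group_ring"
  show "f * g * h = f * (g * h)"
    by (simp only: group_ring_mult_comm[of "f * g" h] group_ring_left_comm[of h f g]
        group_ring_mult_comm[of h g])
  show "f * g = g * f" by (rule group_ring_mult_comm)
  show "1 * f = f"
  proof (rule gr_eqI)
    fix z
    have c: "gr_coeff (of_grp (1::'a)) = (\<lambda>x. if x = 1 then 1 else 0)"
      by transfer simp
    have s: "gr_supp (of_grp (1::'a)) = {1}"
      by (auto simp: gr_supp_def c)
    have "inverse (1::'a) = 1" by (rule grp_inverse_unique) simp
    then show "gr_coeff (1 * f) z = gr_coeff f z"
      by (simp add: one_group_ring_def gr_coeff_times s c)
  qed
  show "(f + g) * h = f * h + g * h" by (rule group_ring_distrib_right)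
  show "f * (g + h) = f * g + f * h"
    by (simp only: group_ring_mult_comm[of f] group_ring_distrib_right)
  show "0 * f = 0" by (rule group_ring_zero_times)
  show "f * 0 = 0" by (simp only: group_ring_mult_comm[of f] group_ring_zero_times)
  show "(0 :: 'a group_ring) \<noteq> 1"
  proof
    assume "(0 :: 'a group_ring) = 1"
    then have "gr_coeff (0 :: 'a group_ring) 1 = gr_coeff 1 1" by simp
    then show False unfolding one_group_ring_def by transfer simp
  qed
  show "f * g \<noteq> 0" if "f \<noteq> 0" "g \<noteq> 0"
  proof -
    obtain M :: "'a set" where M: "pointed_cone M" and tot: "\<And>x. x \<in> M \<or> inverse x \<in> M"
      using total_cone_exists by blast
    have ne: "gr_supp u \<noteq> {}" if "u \<noteq> 0" for u :: "'a group_ring"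
      using that unfolding gr_supp_def by transfer auto
    obtain a where a: "a \<in> gr_supp f" "\<And>x. x \<in> gr_supp f \<Longrightarrow> inverse x * a \<in> M"
      using cone_maximum[OF M tot finite_gr_supp ne[OF \<open>f \<noteq> 0\<close>]] by blast
    obtain b where b: "b \<in> gr_supp g" "\<And>x. x \<in> gr_supp g \<Longrightarrow> inverse x * b \<in> M"
      using cone_maximum[OF M tot finite_gr_supp ne[OF \<open>g \<noteq> 0\<close>]] by blast
    have zero: "gr_coeff f x * gr_coeff g (inverse x * (a * b)) = 0"
      if x: "x \<in> gr_supp f" "x \<noteq> a" for x
    proof (rule ccontr)
      assume "\<not> ?thesis"
      then have "inverse x * (a * b) \<in> gr_supp g" by (auto simp: gr_supp_def)
      then have "inverse (inverse x * (a * b)) * b \<in> M" by (rule b)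
      also have "inverse (inverse x * (a * b)) * b = inverse (inverse x * a)"
        by (simp add: grp_inverse_mult grp_inverse_inverse mult.assoc grp_left_inverse)
      finally have "inverse x * a = 1"
        using a(2)[OF x(1)] M unfolding pointed_cone_def by blast
      then show False
        using x(2) by (metis grp_cancel_right mult_1_right)
    qed
    have "gr_coeff (f * g) (a * b) = gr_coeff f a * gr_coeff g (inverse a * (a * b))"
      unfolding gr_coeff_times
      by (subst sum.remove[OF finite_gr_supp a(1)]) (simp add: zero)
    also have "\<dots> \<noteq> 0"
      using a(1) b(1) by (simp add: grp_cancel_left gr_supp_def)
    finally show "f * g \<noteq> 0" by (auto simp: zero_group_ring.rep_eq)
  qed
qed

end

text \<open>In \<open>\<int>P[y\<^sub>1, y\<^sub>2] = (\<int>P[y\<^sub>1])[y\<^sub>2]\<close>, \<open>y\<^sub>1\<close> is the inner and \<open>y\<^sub>2\<close> the outer variable.\<close>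

type_synonym 'p pol2 = "'p group_ring poly poly"
type_synonym 'p rat2 = "'p group_ring poly poly fract"

definition pvar1 :: "'p::torsion_free_ab_group_mult pol2" where
  "pvar1 = [:[:0, 1:]:]"

definition pvar2 :: "'p::torsion_free_ab_group_mult pol2" where
  "pvar2 = [:0, 1:]"

definition fvar1 :: "'p::torsion_free_ab_group_mult rat2" where
  "fvar1 = to_fract pvar1"

definition fvar2 :: "'p::torsion_free_ab_group_mult rat2" where
  "fvar2 = to_fract pvar2"

definition const_P :: "'p::torsion_free_ab_group_mult \<Rightarrow> 'p rat2" where
  "const_P p = to_fract [:[:of_grp p:]:]"

definition denom_monomial :: "int \<times> int \<Rightarrow> 'p::torsion_free_ab_group_mult rat2" where
  "denom_monomial d = fvar1 powi fst d * fvar2 powi snd d"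

definition is_denom_vector :: "'p::torsion_free_ab_group_mult rat2 \<Rightarrow> int \<times> int \<Rightarrow> bool" where
  "is_denom_vector f d \<longleftrightarrow>
     (\<exists>N :: 'p pol2. \<not> pvar1 dvd N \<and> \<not> pvar2 dvd N \<and> f = to_fract N / denom_monomial d)"

text \<open>The numerator \<open>N\<close> is divisible by neither variable, which makes the exponents unique;
  they may be negative. Meaningful for nonzero Laurent polynomials, for which there is exactly one such \<open>d\<close>.
  The pair \<open>(d\<^sub>1, d\<^sub>2)\<close> stands for \<open>d\<^sub>1 \<alpha>\<^sub>1 + d\<^sub>2 \<alpha>\<^sub>2\<close> in the root lattice.\<close>

definition denom_vector :: "'p::torsion_free_ab_group_mult rat2 \<Rightarrow> int \<times> int" where
  "denom_vector f = (THE d. is_denom_vector f d)"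

definition simple_root :: "nat \<Rightarrow> int \<times> int" where
  "simple_root i = (if i = 1 then (1, 0) else (0, 1))"

definition simple_refl :: "nat \<Rightarrow> nat \<Rightarrow> nat \<Rightarrow> int \<times> int \<Rightarrow> int \<times> int" where
  "simple_refl b c i = (\<lambda>(d1, d2).
     if i = 1 then (- d1 + int b * d2, d2) else (d1, int c * d1 - d2))"

text \<open>The matrices of \<open>s\<^sub>1\<close>, \<open>s\<^sub>2\<close> act on column vectors; \<open>W\<close> is the subgroup they generate
  in the group of bijections of \<open>\<int>\<times>\<int>\<close>, and consists of linear maps because they are linear.\<close>

definition weyl_group :: "nat \<Rightarrow> nat \<Rightarrow> (int \<times> int \<Rightarrow> int \<times> int) monoid" where
  "weyl_group b c = subgroup_generated (BijGroup UNIV) {simple_refl b c 1, simple_refl b c 2}"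

text \<open>\<open>group.ord\<close> is \<open>0\<close> on elements of infinite order, so \<open>0\<close> encodes \<open>h = \<infinity>\<close> here.\<close>

definition coxeter_number :: "nat \<Rightarrow> nat \<Rightarrow> nat" where
  "coxeter_number b c =
     group.ord (weyl_group b c) (simple_refl b c 1 \<otimes>\<^bsub>weyl_group b c\<^esub> simple_refl b c 2)"

definition real_roots :: "nat \<Rightarrow> nat \<Rightarrow> (int \<times> int) set" where
  "real_roots b c = {w (simple_root i) | w i. w \<in> carrier (weyl_group b c) \<and> i \<in> {1, 2}}"

definition pos_real_roots :: "nat \<Rightarrow> nat \<Rightarrow> (int \<times> int) set" where
  "pos_real_roots b c = {d \<in> real_roots b c. 0 \<le> fst d \<and> 0 \<le> snd d}"

text \<open>\<open>\<langle>m\<rangle>\<close>, the element of \<open>{1, 2}\<close> congruent to \<open>m\<close> modulo 2.\<close>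

definition ang :: "nat \<Rightarrow> nat" where
  "ang m = (if odd m then 1 else 2)"

text \<open>\<open>w\<^sub>1(m) = s\<^sub>1 s\<^sub>2 s\<^sub>1 \<dots>\<close> and \<open>w\<^sub>2(m) = s\<^sub>2 s\<^sub>1 s\<^sub>2 \<dots>\<close>, both of length \<open>m\<close>, built up on the right.\<close>

fun w1 :: "nat \<Rightarrow> nat \<Rightarrow> nat \<Rightarrow> int \<times> int \<Rightarrow> int \<times> int" where
  "w1 b c 0 = id"
| "w1 b c (Suc m) = w1 b c m \<circ> simple_refl b c (ang (Suc m))"

fun w2 :: "nat \<Rightarrow> nat \<Rightarrow> nat \<Rightarrow> int \<times> int \<Rightarrow> int \<times> int" where
  "w2 b c 0 = id"
| "w2 b c (Suc m) = w2 b c m \<circ> simple_refl b c (ang (Suc (Suc m)))"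

end

theory Submission
  imports Defs
begin

text \<open>
  Write every cluster variable as a quotient \<open>N / (D * y\<^sub>1 ^ d\<^sub>1 * y\<^sub>2 ^ d\<^sub>2)\<close> of
  polynomials whose values at \<open>(0, 1)\<close> and \<open>(1, 0)\<close> are nonzero with nonnegative coefficients. No leading
  terms cancel, so the exponent vector is a tropical evaluation; by the Laurent phenomenon it is the
  denominator vector, and \<open>\<delta>(m - 1) + \<delta>(m + 1) = e\<^sub>m * max \<delta>(m) 0\<close> with \<open>e\<^sub>m\<close> alternating
  between \<open>b\<close> and \<open>c\<close>. As long as the vectors stay nonnegative this is the recursion of the roots
  \<open>w\<^sub>1(m) \<alpha>\<close>. For \<open>bc \<ge> 4\<close> these never leave the positive cone. For \<open>bc \<le> 3\<close> periodicity is
  checked on the ratios \<open>q\<^sub>m y\<^sub>m ^ e\<^sub>m / r\<^sub>m\<close>, from whose recursion the coefficients disappear, so that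
  only the Y-systems of types \<open>A\<^sub>2\<close>, \<open>B\<^sub>2\<close>, \<open>G\<^sub>2\<close> remain.
\<close>

subsection \<open>Tropical valuation of subtraction-free Laurent expressions\<close>

text \<open>The exchange relations contain no subtraction, but the Laurent phenomenon is obtained by
  cancelling inside a ring, and that argument says nothing about signs in the numerators. Hence the
  two facts are proved apart: tropical exponents are defined for quotients with an arbitrary
  positive denominator \<open>D\<close>, Laurentness is membership in a ring, and
  \<open>denom_vector_eq\<close> joins them. In finite type, \<open>yhat\<close> determines
  \<open>y\<close> up to a coefficient where its exponent is 1; where the exponent is 2 or 3 it
  fixes only a power of \<open>y\<close>, so those indices rest on a further identity among the
  factors \<open>1 + yhat\<close>. In the infinite case an invariant inequality, not a closed
  formula, keeps the roots positive.\<close>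

definition pos_group_ring :: "'p group_ring \<Rightarrow> bool" where
  "pos_group_ring f \<longleftrightarrow> f \<noteq> 0 \<and> (\<forall>x. 0 \<le> gr_coeff f x)"

lemma gr_coeff_0 [simp]: "gr_coeff 0 x = 0"
  by transfer simp

lemma gr_coeff_plus [simp]: "gr_coeff (f + g) x = gr_coeff f x + gr_coeff g x"
  by transfer simp

lemma not_pos_group_ring_0 [simp]: "\<not> pos_group_ring 0"
  by (simp add: pos_group_ring_def)

text \<open>Nonnegative coefficients cannot cancel. The alternative \<open>g = 0\<close> covers a
  summand whose monomial vanishes at the evaluation point.\<close>

lemma pos_group_ring_add:
  assumes "pos_group_ring f" "g = 0 \<or> pos_group_ring g"
  shows "pos_group_ring (f + g)"
proof -
  from assms(1) obtain x where "gr_coeff f x \<noteq> 0"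
    unfolding pos_group_ring_def by (metis gr_eqI gr_coeff_0)
  with assms have "gr_coeff (f + g) x \<noteq> 0"
    unfolding pos_group_ring_def by (metis add_nonneg_eq_0_iff add.right_neutral gr_coeff_plus)
  with assms show ?thesis
    unfolding pos_group_ring_def by (metis add_nonneg_nonneg add.right_neutral gr_coeff_0 gr_coeff_plus)
qed

lemma pos_group_ring_mult:
  fixes f g :: "'p::torsion_free_ab_group_mult group_ring"
  assumes "pos_group_ring f" "pos_group_ring g"
  shows "pos_group_ring (f * g)"
  using assms unfolding pos_group_ring_def by (auto simp: gr_coeff_times intro: sum_nonneg)

lemma pos_group_ring_of_grp [simp]: "pos_group_ring (of_grp p)"
proof -
  have c: "gr_coeff (of_grp p) = (\<lambda>x. if x = p then 1 else 0)"
    by transfer simp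
  have "gr_coeff (of_grp p) p \<noteq> 0"
    by (simp add: c)
  then have "of_grp p \<noteq> 0"
    by (metis gr_coeff_0)
  then show ?thesis
    by (simp add: pos_group_ring_def c)
qed

lemma pos_group_ring_1 [simp]: "pos_group_ring (1 :: 'p::torsion_free_ab_group_mult group_ring)"
  by (simp add: one_group_ring_def)

lemma of_grp_mult: "of_grp (p * p') = of_grp p * of_grp (p' :: 'p::torsion_free_ab_group_mult)"
proof (rule gr_eqI)
  fix z
  have c: "gr_coeff (of_grp p) = (\<lambda>x. if x = p then 1 else 0)" for p :: 'p
    by transfer simp
  have s: "gr_supp (of_grp p) = {p}"
    by (auto simp: gr_supp_def c)
  have "inverse p * z = p' \<longleftrightarrow> z = p * p'"
    by (metis grp_cancel_left grp_cancel_right)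
  then show "gr_coeff (of_grp (p * p')) z = gr_coeff (of_grp p * of_grp p') z"
    by (simp add: gr_coeff_times s c)
qed

text \<open>The inner evaluation is that of \<open>y\<^sub>2\<close>, so the two values are those at
  (0, 1) and (1, 0). A nonzero value at \<open>y\<^sub>1 = 0\<close> rules out divisibility by
  \<open>y\<^sub>1\<close>, and likewise for \<open>y\<^sub>2\<close>.\<close>

definition edge_positive :: "'p::torsion_free_ab_group_mult pol2 \<Rightarrow> bool" where
  "edge_positive N \<longleftrightarrow> pos_group_ring (poly (poly N 1) 0) \<and> pos_group_ring (poly (poly N 0) 1)"

lemma edge_positive_mult: "edge_positive M \<Longrightarrow> edge_positive N \<Longrightarrow> edge_positive (M * N)"
  by (simp add: edge_positive_def pos_group_ring_mult)

lemma edge_positive_1 [simp]: "edge_positive 1"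
  by (simp add: edge_positive_def)

lemma edge_positive_const [simp]: "edge_positive [:[:of_grp p:]:]"
  by (simp add: edge_positive_def)

lemma edge_positive_not_dvd:
  assumes "edge_positive N"
  shows "\<not> pvar1 dvd N" "\<not> pvar2 dvd N"
  using assms by (auto simp: edge_positive_def pvar1_def pvar2_def elim!: dvdE)

lemma edge_positive_nonzero: "edge_positive N \<Longrightarrow> N \<noteq> 0"
  by (auto simp: edge_positive_def)

text \<open>At each of the two points one variable is 0 and the other is 1. The disjunctions ensure
  that at least one summand survives there, and the other adds something positive or zero.\<close>

lemma edge_positive_add_monomials:
  assumes "edge_positive M" "edge_positive N" "i = 0 \<or> k = 0" "j = 0 \<or> l = 0"
  shows "edge_positive (M * (pvar1 ^ i * pvar2 ^ j) + N * (pvar1 ^ k * pvar2 ^ l))"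
proof -
  have *: "pos_group_ring (a * 0 ^ i + b * 0 ^ k)"
    if "pos_group_ring a" "pos_group_ring b" "i = 0 \<or> k = 0"
    for a b :: "'a group_ring" and i k :: nat
  proof (cases "i = 0")
    case True
    with that show ?thesis
      by (intro pos_group_ring_add) (auto simp: power_0_left)
  next
    case False
    with that show ?thesis by (simp add: power_0_left)
  qed
  show ?thesis
    using *[of _ _ i k] *[of _ _ j l] assms
    by (simp add: edge_positive_def pvar1_def pvar2_def)
qed

section \<open>Divisibility by the two variables and uniqueness of monomial denominators\<close>

lemma prime_elem_pvar1: "prime_elem (pvar1 :: 'p::torsion_free_ab_group_mult pol2)"
proof -
  have "prime_elem ([:0, 1:] :: 'p group_ring poly)"
    by (rule prime_elemI) (auto simp: dvd_iff_poly_eq_0 is_unit_poly_iff)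
  then show ?thesis
    unfolding pvar1_def by (rule lift_prime_elem_poly)
qed

lemma prime_elem_pvar2: "prime_elem (pvar2 :: 'p::torsion_free_ab_group_mult pol2)"
  unfolding pvar2_def
  by (rule prime_elemI) (auto simp: dvd_iff_poly_eq_0 is_unit_poly_iff)

lemma pvar_not_dvd: "\<not> pvar1 dvd (pvar2 :: 'p::torsion_free_ab_group_mult pol2)"
  "\<not> pvar2 dvd (pvar1 :: 'p::torsion_free_ab_group_mult pol2)"
  by (auto simp: pvar1_def pvar2_def const_poly_dvd_iff dvd_iff_poly_eq_0 coeff_pCons is_unit_poly_iff
      intro!: exI[of _ 1])

lemma fvar_nonzero [simp]: "fvar1 \<noteq> 0" "fvar2 \<noteq> 0"
  by (auto simp: fvar1_def fvar2_def pvar1_def pvar2_def)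

lemma denom_monomial_nonzero [simp]: "denom_monomial d \<noteq> 0"
  by (simp add: denom_monomial_def)

lemma denom_monomial_0 [simp]: "denom_monomial 0 = 1"
  by (simp add: denom_monomial_def)

lemma denom_monomial_add: "denom_monomial (d + e) = denom_monomial d * denom_monomial e"
  by (simp add: denom_monomial_def power_int_add)

lemma denom_monomial_diff: "denom_monomial (d - e) = denom_monomial d / denom_monomial e"
  by (simp add: denom_monomial_def power_int_diff)

lemma denom_monomial_of_nat:
  "denom_monomial (int i, int j) = to_fract (pvar1 ^ i * pvar2 ^ j)"
proof -
  have "to_fract (x ^ n) = to_fract x ^ n" for x :: "'a pol2" and n
    by (induction n) simp_all
  then show ?thesis
    by (simp add: denom_monomial_def fvar1_def fvar2_def)
qed

text \<open>Both variables are prime, so once negative exponents are cleared, divisibility of the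
  two sides by each variable reveals the exponents.\<close>

lemma denom_monomial_eqD:
  fixes M N :: "'p::torsion_free_ab_group_mult pol2"
  assumes eq: "to_fract M * denom_monomial d = to_fract N * denom_monomial e"
    and M: "\<not> pvar1 dvd M" "\<not> pvar2 dvd M" and N: "\<not> pvar1 dvd N" "\<not> pvar2 dvd N"
  shows "d = e"
proof -
  \<comment> \<open>Splitting off the componentwise minimum leaves natural exponents, and in each
    variable at most one side keeps a positive power; hence bare divisibility, without
    multiplicities, decides equality.\<close>
  define f where "f = (min (fst d) (fst e), min (snd d) (snd e))"
  define i j k l where "i = nat (fst (d - f))" and "j = nat (snd (d - f))"
    and "k = nat (fst (e - f))" and "l = nat (snd (e - f))"
  have de: "d - f = (int i, int j)" "e - f = (int k, int l)"
    by (auto simp: prod_eq_iff i_def j_def k_def l_def f_def)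
  have 0: "i = 0 \<or> k = 0" "j = 0 \<or> l = 0"
    by (auto simp: i_def j_def k_def l_def f_def)
  have "to_fract M * denom_monomial (d - f) = to_fract N * denom_monomial (e - f)"
    using eq by (simp add: denom_monomial_diff)
  then have eq': "M * (pvar1 ^ i * pvar2 ^ j) = N * (pvar1 ^ k * pvar2 ^ l)"
    unfolding de denom_monomial_of_nat by (simp only: to_fract_eq_iff flip: to_fract_mult)
  have power: "p dvd x ^ n \<longleftrightarrow> n \<noteq> 0 \<and> p dvd x" if "prime_elem p" for p x :: "'p pol2" and n
    using that by (cases n) (auto simp: prime_elem_dvd_mult_iff prime_elem_not_unit dest: prime_elem_dvd_power)
  note dvd = prime_elem_dvd_mult_iff power pvar_not_dvd prime_elem_pvar1 prime_elem_pvar2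
  have "pvar1 dvd M * (pvar1 ^ i * pvar2 ^ j) \<longleftrightarrow> i \<noteq> 0"
    using M by (simp add: dvd)
  moreover have "pvar1 dvd N * (pvar1 ^ k * pvar2 ^ l) \<longleftrightarrow> k \<noteq> 0"
    using N by (simp add: dvd)
  moreover have "pvar2 dvd M * (pvar1 ^ i * pvar2 ^ j) \<longleftrightarrow> j \<noteq> 0"
    using M by (simp add: dvd)
  moreover have "pvar2 dvd N * (pvar1 ^ k * pvar2 ^ l) \<longleftrightarrow> l \<noteq> 0"
    using N by (simp add: dvd)
  ultimately have "i = k" "j = l"
    using 0 eq' by auto
  then have "d - f = e - f" using de by simp
  then show ?thesis by simp
qed

text \<open>The exponent \<open>d\<close> is the tropical evaluation of a subtraction-free expression; positivity on the
  two coordinate edges excludes cancellation in the leading terms.\<close>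

definition has_trop :: "'p::torsion_free_ab_group_mult rat2 \<Rightarrow> int \<times> int \<Rightarrow> bool" where
  "has_trop f d \<longleftrightarrow>
     (\<exists>N D. edge_positive N \<and> edge_positive D \<and> f * to_fract D * denom_monomial d = to_fract N)"

lemma has_trop_unique:
  assumes "has_trop f d" "has_trop f e"
  shows "d = e"
proof -
  obtain N D N' D' where *: "edge_positive N" "edge_positive D" "f * to_fract D * denom_monomial d = to_fract N"
    "edge_positive N'" "edge_positive D'" "f * to_fract D' * denom_monomial e = to_fract N'"
    using assms unfolding has_trop_def by blast
  have "to_fract (N' * D) * denom_monomial d = to_fract (N * D') * denom_monomial e"
    by (simp flip: *(3,6))
  then show ?thesis
    by (rule denom_monomial_eqD) (simp_all add: * edge_positive_not_dvd edge_positive_mult)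
qed

lemma has_trop_nonzero: "has_trop f d \<Longrightarrow> f \<noteq> 0"
  by (auto simp: has_trop_def dest: edge_positive_nonzero)

lemma has_trop_mult:
  assumes "has_trop f d" "has_trop g e"
  shows "has_trop (f * g) (d + e)"
proof -
  obtain N D N' D' where *: "edge_positive N" "edge_positive D" "f * to_fract D * denom_monomial d = to_fract N"
    "edge_positive N'" "edge_positive D'" "g * to_fract D' * denom_monomial e = to_fract N'"
    using assms unfolding has_trop_def by blast
  have "f * g * to_fract (D * D') * denom_monomial (d + e) = to_fract (N * N')"
    by (simp add: denom_monomial_add flip: *(3,6))
  then show ?thesis
    using * edge_positive_mult unfolding has_trop_def by blast
qed

text \<open>Numerator and denominator enter \<open>has_trop\<close> symmetrically. This permits
  division, hence solving an exchange relation for the new variable.\<close>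

lemma has_trop_inverse:
  assumes "has_trop f d"
  shows "has_trop (1 / f) (- d)"
proof -
  obtain N D where *: "edge_positive N" "edge_positive D" "f * to_fract D * denom_monomial d = to_fract N"
    using assms unfolding has_trop_def by blast
  have "1 / f * to_fract N * denom_monomial (0 - d) = to_fract D"
    using has_trop_nonzero[OF assms] unfolding denom_monomial_diff by (simp flip: *(3))
  then show ?thesis
    using * unfolding has_trop_def by auto
qed

lemma has_trop_divide: "has_trop f d \<Longrightarrow> has_trop g e \<Longrightarrow> has_trop (f / g) (d - e)"
  using has_trop_mult[OF _ has_trop_inverse, of f d g e] by simp

lemma has_trop_const [simp]: "has_trop (const_P p) 0"
  unfolding has_trop_def const_P_def
  by (rule exI[of _ "[:[:of_grp p:]:]"], rule exI[of _ 1]) simp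

lemma has_trop_1 [simp]: "has_trop 1 0"
  unfolding has_trop_def by (rule exI[of _ 1], rule exI[of _ 1]) simp

lemma has_trop_power: "has_trop f d \<Longrightarrow> has_trop (f ^ n) (int n * fst d, int n * snd d)"
proof (induction n)
  case (Suc n)
  then have "has_trop (f * f ^ n) (d + (int n * fst d, int n * snd d))"
    by (intro has_trop_mult) auto
  then show ?case
    by (simp add: plus_prod_def algebra_simps)
qed (simp flip: zero_prod_def)

text \<open>The exponents belong to the denominator, so the larger one dominates. In each coordinate
  the maximum is attained by one summand, which is the hypothesis of
  \<open>edge_positive_add_monomials\<close>.\<close>

lemma has_trop_add:
  assumes "has_trop f d" "has_trop g e"
  shows "has_trop (f + g) (max (fst d) (fst e), max (snd d) (snd e))" (is "has_trop _ ?m")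
proof -
  obtain N D N' D' where *: "edge_positive N" "edge_positive D" "f * to_fract D * denom_monomial d = to_fract N"
    "edge_positive N'" "edge_positive D'" "g * to_fract D' * denom_monomial e = to_fract N'"
    using assms unfolding has_trop_def by blast
  define i j k l where "i = nat (fst (?m - d))" and "j = nat (snd (?m - d))"
    and "k = nat (fst (?m - e))" and "l = nat (snd (?m - e))"
  have de: "?m - d = (int i, int j)" "?m - e = (int k, int l)"
    by (auto simp: prod_eq_iff i_def j_def k_def l_def)
  have 0: "i = 0 \<or> k = 0" "j = 0 \<or> l = 0"
    by (auto simp: i_def j_def k_def l_def)
  have m: "?m = d + (int i, int j)" "?m = e + (int k, int l)"
    unfolding de[symmetric] by simp_all
  have "(f + g) * to_fract (D * D') * denom_monomial ?m =
      f * to_fract (D * D') * denom_monomial ?m + g * to_fract (D * D') * denom_monomial ?m"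
    by (simp add: ring_distribs)
  also have "f * to_fract (D * D') * denom_monomial ?m = to_fract (N * D' * (pvar1 ^ i * pvar2 ^ j))"
    unfolding m(1) denom_monomial_add denom_monomial_of_nat by (simp flip: *(3))
  also have "g * to_fract (D * D') * denom_monomial ?m = to_fract (N' * D * (pvar1 ^ k * pvar2 ^ l))"
    unfolding m(2) denom_monomial_add denom_monomial_of_nat by (simp flip: *(6))
  finally have "(f + g) * to_fract (D * D') * denom_monomial ?m =
      to_fract (N * D' * (pvar1 ^ i * pvar2 ^ j) + N' * D * (pvar1 ^ k * pvar2 ^ l))"
    by simp
  then show ?thesis
    using edge_positive_add_monomials[OF edge_positive_mult[OF *(1,5)] edge_positive_mult[OF *(4,2)] 0]
      edge_positive_mult[OF *(2,5)]
    unfolding has_trop_def by blast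
qed

lemma has_trop_fvar: "has_trop fvar1 (- simple_root 1)" "has_trop fvar2 (- simple_root 2)"
  unfolding has_trop_def
  by (rule exI[of _ 1], rule exI[of _ 1], simp add: denom_monomial_def simple_root_def)+

subsection \<open>Laurent polynomials\<close>

definition laurent :: "'p::torsion_free_ab_group_mult rat2 set" where
  "laurent = {f. \<exists>N d. f = to_fract N / denom_monomial d}"

lemma laurent_common_denom:
  fixes f g :: "'p::torsion_free_ab_group_mult rat2"
  assumes "f \<in> laurent" "g \<in> laurent"
  obtains M N d where "f = to_fract M / denom_monomial d" "g = to_fract N / denom_monomial d"
proof -
  obtain M N d e where *: "f = to_fract M / denom_monomial d" "g = to_fract N / denom_monomial e"
    using assms unfolding laurent_def by blast
  define m where "m = (max (fst d) (fst e), max (snd d) (snd e))"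
  have "\<exists>K. to_fract L / denom_monomial d' = to_fract K / denom_monomial m"
    if "fst d' \<le> fst m" "snd d' \<le> snd m" for d' and L :: "'p pol2"
  proof -
    define i j where "i = nat (fst (m - d'))" and "j = nat (snd (m - d'))"
    have "m - d' = (int i, int j)"
      using that by (auto simp: prod_eq_iff i_def j_def)
    then have m: "m = d' + (int i, int j)"
      unfolding \<open>m - d' = (int i, int j)\<close>[symmetric] by simp
    have "to_fract L / denom_monomial d' = to_fract (L * (pvar1 ^ i * pvar2 ^ j)) / denom_monomial m"
      unfolding m denom_monomial_add to_fract_mult[of L] denom_monomial_of_nat[symmetric] by simp
    then show ?thesis by blast
  qed
  from this[of d M] this[of e N] obtain K L where
    "f = to_fract K / denom_monomial m" "g = to_fract L / denom_monomial m"
    by (auto simp: * m_def)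
  then show ?thesis by (rule that)
qed

lemma laurent_add: "f \<in> laurent \<Longrightarrow> g \<in> laurent \<Longrightarrow> f + g \<in> laurent"
  by (erule (1) laurent_common_denom)
    (auto simp: laurent_def simp flip: add_divide_distrib to_fract_add)

lemma laurent_diff: "f \<in> laurent \<Longrightarrow> g \<in> laurent \<Longrightarrow> f - g \<in> laurent"
  by (erule (1) laurent_common_denom)
    (auto simp: laurent_def simp flip: diff_divide_distrib to_fract_diff)

lemma laurentI: "f = to_fract N / denom_monomial d \<Longrightarrow> f \<in> laurent"
  unfolding laurent_def by blast

lemma laurent_mult:
  assumes "f \<in> laurent" "g \<in> laurent"
  shows "f * g \<in> laurent"
proof -
  obtain M N d e where "f = to_fract M / denom_monomial d" "g = to_fract N / denom_monomial e"
    using assms unfolding laurent_def by blast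
  then have "f * g = to_fract (M * N) / denom_monomial (d + e)"
    by (simp add: denom_monomial_add)
  then show ?thesis by (rule laurentI)
qed

lemma laurent_to_fract: "to_fract N \<in> laurent"
  by (rule laurentI[of _ N 0]) simp

lemma laurent_inverse_monomial: "1 / denom_monomial d \<in> laurent"
  by (rule laurentI[of _ 1 d]) simp

text \<open>For the outer variable this is \<open>order_decomp\<close>. For the inner one, dividing
  by \<open>y\<^sub>1\<close> lowers the \<open>y\<^sub>1\<close>-degree of the leading coefficient
  in \<open>y\<^sub>2\<close>, which bounds the number of divisions.\<close>

lemma pvar1_decomp:
  fixes N :: "'p::torsion_free_ab_group_mult pol2"
  assumes "N \<noteq> 0"
  shows "\<exists>i M. N = pvar1 ^ i * M \<and> \<not> pvar1 dvd M"
  using assms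
proof (induction "degree (lead_coeff N)" arbitrary: N rule: less_induct)
  case less
  show ?case
  proof (cases "pvar1 dvd N")
    case True
    then obtain K where K: "N = pvar1 * K" ..
    with less.prems have "K \<noteq> 0" by auto
    then have "lead_coeff N = [:0, 1:] * lead_coeff K"
      unfolding K lead_coeff_mult by (simp add: pvar1_def)
    then have "degree (lead_coeff K) < degree (lead_coeff N)"
      using \<open>K \<noteq> 0\<close> by (simp add: degree_mult_eq)
    from less.hyps[OF this \<open>K \<noteq> 0\<close>] obtain i M where "K = pvar1 ^ i * M" "\<not> pvar1 dvd M"
      by blast
    with K show ?thesis
      by (intro exI[of _ "Suc i"] exI[of _ M]) (simp add: mult.assoc)
  next
    case False
    then show ?thesis
      by (intro exI[of _ 0] exI[of _ N]) simp
  qed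
qed

text \<open>Laurentness gives existence: the powers of both variables are stripped off the
  numerator. The tropical exponent gives uniqueness: by primality, multiplying a reduced numerator
  by the positive \<open>D\<close> keeps it free of both variables, so its exponent must be
  \<open>d\<close>.\<close>

lemma denom_vector_eq:
  assumes "f \<in> laurent" "has_trop f d"
  shows "is_denom_vector f d" "denom_vector f = d"
proof -
  have unique: "e = d" if e: "is_denom_vector f e" for e
  proof -
    obtain N where N: "\<not> pvar1 dvd N" "\<not> pvar2 dvd N" "f = to_fract N / denom_monomial e"
      using e unfolding is_denom_vector_def by blast
    obtain M D where D: "edge_positive M" "edge_positive D" "f * to_fract D * denom_monomial d = to_fract M"
      using assms(2) unfolding has_trop_def by blast
    have "to_fract M * denom_monomial e = to_fract (N * D) * denom_monomial d"
      by (simp add: N(3) flip: D(3))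
    then show ?thesis
      by (rule denom_monomial_eqD)
        (use N(1,2) D(1,2) in \<open>simp_all add: edge_positive_not_dvd prime_elem_dvd_mult_iff prime_elem_pvar1 prime_elem_pvar2\<close>)
  qed
  obtain N e where f: "f = to_fract N / denom_monomial e"
    using assms(1) unfolding laurent_def by blast
  then have "N \<noteq> 0"
    using has_trop_nonzero[OF assms(2)] by auto
  then obtain i M where M: "N = pvar1 ^ i * M" "\<not> pvar1 dvd M"
    using pvar1_decomp by blast
  have "M \<noteq> 0"
    using M(2) by auto
  obtain j K where K: "M = pvar2 ^ j * K" "\<not> pvar2 dvd K"
    using order_decomp[OF \<open>M \<noteq> 0\<close>, of 0] unfolding pvar2_def minus_zero by blast
  have "\<not> pvar1 dvd K"
    using K(1) M(2) by (metis dvd_mult)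
  have "to_fract N = denom_monomial (int i, int j) * to_fract K"
    unfolding M(1) K(1) denom_monomial_of_nat to_fract_mult[symmetric] by (simp only: mult.assoc)
  then have "f = to_fract K / denom_monomial (e - (int i, int j))"
    by (simp add: f denom_monomial_diff)
  then have dv: "is_denom_vector f (e - (int i, int j))"
    using K(2) \<open>\<not> pvar1 dvd K\<close> unfolding is_denom_vector_def by blast
  show d: "is_denom_vector f d"
    using dv unfolding unique[OF dv] .
  from d unique show "denom_vector f = d"
    unfolding denom_vector_def by (rule the_equality)
qed

lemma const_P_mult: "const_P (p * p') = const_P p * const_P p'"
  by (simp add: const_P_def of_grp_mult flip: to_fract_mult)

lemma const_P_nonzero [simp]: "const_P p \<noteq> 0"
  using has_trop_const has_trop_nonzero by blast

lemma const_P_1 [simp]: "const_P 1 = 1"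
  by (metis const_P_def one_group_ring_def one_pCons to_fract_1)

lemma const_P_power: "const_P (p ^ n) = const_P p ^ n"
  by (induction n) (simp_all add: const_P_mult)

lemma const_P_inverse: "const_P (inverse p) = 1 / const_P p"
  by (simp add: field_simps grp_right_inverse flip: const_P_mult)

subsection \<open>Exchange patterns of rank two\<close>

text \<open>A congruence modulo \<open>x\<close> of which the cofactor must stay in
  \<open>L\<close>, a mere subset of the field; in the field itself divisibility by \<open>x\<close>
  would be void.\<close>

lemma binomial_mod:
  fixes x t s :: "'a::comm_ring_1"
  assumes L: "\<And>f g. f \<in> L \<Longrightarrow> g \<in> L \<Longrightarrow> f + g \<in> L" "\<And>f g. f \<in> L \<Longrightarrow> g \<in> L \<Longrightarrow> f * g \<in> L"
    and "0 \<in> L" "1 \<in> L" "x \<in> L" "t \<in> L" "s \<in> L"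
  shows "\<exists>G\<in>L. (x * t + s) ^ n = s ^ n + x * G"
proof (induction n)
  case 0
  show ?case by (intro bexI[of _ 0]) (use assms in auto)
next
  case (Suc n)
  then obtain G where G: "G \<in> L" "(x * t + s) ^ n = s ^ n + x * G" by blast
  have "s ^ n \<in> L"
    by (induction n) (simp_all add: assms)
  then have "t * s ^ n + x * t * G + s * G \<in> L"
    by (intro L \<open>x \<in> L\<close> \<open>t \<in> L\<close> \<open>s \<in> L\<close> G(1))
  moreover have "(x * t + s) ^ Suc n = s ^ Suc n + x * (t * s ^ n + x * t * G + s * G)"
    unfolding power_Suc G(2) by (simp add: algebra_simps)
  ultimately show ?case by blast
qed

text \<open>The exponent of \<open>y m\<close> in its own exchange relation. The coefficient
  relation at \<open>m\<close> carries the exponent of the neighbours, hence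
  \<open>alt_exp b c (m + 1)\<close>.\<close>

definition alt_exp :: "nat \<Rightarrow> nat \<Rightarrow> int \<Rightarrow> nat" where
  "alt_exp b c m = (if odd m then b else c)"

text \<open>\<open>U\<close> plays the role of the coefficient group inside the ambient field.\<close>

locale exchange_pattern =
  fixes b c :: nat and U :: "'k::field set" and q r y :: "int \<Rightarrow> 'k"
  assumes U_1: "1 \<in> U" and U_mult: "u \<in> U \<Longrightarrow> v \<in> U \<Longrightarrow> u * v \<in> U"
    and U_inverse: "u \<in> U \<Longrightarrow> 1 / u \<in> U" and U_nonzero: "u \<in> U \<Longrightarrow> u \<noteq> 0"
    and q_U: "q m \<in> U" and r_U: "r m \<in> U" and y_nonzero: "y m \<noteq> 0"
    and exponents: "b = 0 \<longleftrightarrow> c = 0"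
    and coeffs: "q (m - 1) * q (m + 1) * r m ^ alt_exp b c (m + 1) = r (m - 1) * r (m + 1)"
    and exchange: "y (m - 1) * y (m + 1) = q m * y m ^ alt_exp b c m + r m"
begin

text \<open>Moving the index by one exchanges parities and so \<open>b\<close> and \<open>c\<close>;
  this reduces the types (2, 1) and (3, 1) to (1, 2) and (1, 3).\<close>

lemma shift: "exchange_pattern c b U (\<lambda>m. q (m + 1)) (\<lambda>m. r (m + 1)) (\<lambda>m. y (m + 1))"
proof
  fix m :: int
  show "q (m - 1 + 1) * q (m + 1 + 1) * r (m + 1) ^ alt_exp c b (m + 1) = r (m - 1 + 1) * r (m + 1 + 1)"
    using coeffs[of "m + 1"] by (cases "even m") (simp_all add: alt_exp_def ac_simps)
  show "y (m - 1 + 1) * y (m + 1 + 1) = q (m + 1) * y (m + 1) ^ alt_exp c b m + r (m + 1)"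
    using exchange[of "m + 1"] by (simp add: alt_exp_def algebra_simps)
qed (simp_all add: U_1 U_mult U_inverse U_nonzero q_U r_U y_nonzero exponents)

lemma reflect: "exchange_pattern b c U (\<lambda>m. q (- m)) (\<lambda>m. r (- m)) (\<lambda>m. y (- m))"
proof
  fix m :: int
  show "q (- (m - 1)) * q (- (m + 1)) * r (- m) ^ alt_exp b c (m + 1) = r (- (m - 1)) * r (- (m + 1))"
    using coeffs[of "- m"] by (cases "even m") (simp_all add: alt_exp_def mult_ac add.commute minus_diff_commute)
  show "y (- (m - 1)) * y (- (m + 1)) = q (- m) * y (- m) ^ alt_exp b c m + r (- m)"
    using exchange[of "- m"] by (cases "even m") (simp_all add: alt_exp_def mult_ac add.commute minus_diff_commute)
qed (simp_all add: U_1 U_mult U_inverse U_nonzero q_U r_U y_nonzero exponents)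

lemma U_divide: "u \<in> U \<Longrightarrow> v \<in> U \<Longrightarrow> u / v \<in> U"
  using U_mult[OF _ U_inverse, of u v] by simp

lemma U_power: "u \<in> U \<Longrightarrow> u ^ n \<in> U"
  by (induction n) (simp_all add: U_1 U_mult)

lemma qr_nonzero [simp]: "q m \<noteq> 0" "r m \<noteq> 0" "y m \<noteq> 0"
  by (simp_all add: q_U r_U U_nonzero y_nonzero)

text \<open>Both \<open>y (m + 4) * y (m + 1) ^ e\<close> and \<open>y (m + 4) * y (m + 2)\<close> lie in the ring generated by four
  consecutive variables, and \<open>y (m + 1) ^ e\<close> and \<open>y (m + 2)\<close> generate its unit ideal.\<close>

lemma ring_step:
  assumes L: "\<And>f g. f \<in> L \<Longrightarrow> g \<in> L \<Longrightarrow> f + g \<in> L" "\<And>f g. f \<in> L \<Longrightarrow> g \<in> L \<Longrightarrow> f * g \<in> L"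
    "\<And>f. f \<in> L \<Longrightarrow> - f \<in> L" and UL: "U \<subseteq> L"
    and yL: "y m \<in> L" "y (m + 1) \<in> L" "y (m + 2) \<in> L" "y (m + 3) \<in> L"
  shows "y (m + 4) \<in> L"
proof -
  define e e' where "e = alt_exp b c (m + 1)" and "e' = alt_exp b c (m + 2)"
  have e3: "alt_exp b c (m + 3) = e"
    by (simp add: e_def alt_exp_def)
  have ee: "e = 0 \<longleftrightarrow> e' = 0"
    using exponents by (auto simp: e_def e'_def alt_exp_def)
  have 1: "1 \<in> L"
    using UL U_1 by blast
  have 0: "0 \<in> L"
    using L(1)[OF 1 L(3)[OF 1]] by simp
  have pow: "f ^ n \<in> L" if "f \<in> L" for f n
    using that by (induction n) (simp_all add: 1 L(2))
  have qr: "q n \<in> L" "r n \<in> L" "1 / q n \<in> L" "1 / r n ^ k \<in> L" for n k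
    using UL q_U r_U U_inverse U_inverse[OF U_power] by blast+
  define x0 x1 x2 x3 x4 where x: "x0 = y m" "x1 = y (m + 1)" "x2 = y (m + 2)" "x3 = y (m + 3)" "x4 = y (m + 4)"
  have xL: "x0 \<in> L" "x1 \<in> L" "x2 \<in> L" "x3 \<in> L"
    using yL by (simp_all add: x)
  have x2: "x2 \<noteq> 0"
    by (simp add: x)
  have ex1: "x0 * x2 = q (m + 1) * x1 ^ e + r (m + 1)"
    using exchange[of "m + 1"] by (simp add: x e_def algebra_simps)
  have ex2: "x1 * x3 = q (m + 2) * x2 ^ e' + r (m + 2)"
    using exchange[of "m + 2"] by (simp add: x e'_def algebra_simps)
  have ex3: "x2 * x4 = q (m + 3) * x3 ^ e + r (m + 3)"
    using exchange[of "m + 3"] e3 by (simp add: x algebra_simps)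
  \<comment> \<open>The coefficient relation enters here: it matches the constant term of
    \<open>ex3 * x1 ^ e\<close> modulo \<open>x2\<close> with that of \<open>ex1\<close>, so that
    the two remaining terms combine to a multiple of \<open>x0 * x2\<close>.\<close>
  have co: "q (m + 3) * r (m + 2) ^ e = r (m + 3) / q (m + 1) * r (m + 1)"
    using coeffs[of "m + 2"] e3 by (simp add: x field_simps)
  obtain G S where GS: "G \<in> L" "S \<in> L" "(x1 * x3) ^ e = r (m + 2) ^ e + x2 * G"
    "r (m + 2) ^ e = (x1 * x3) ^ e + x2 * S"
  proof (cases "e = 0")
    case True
    then show ?thesis
      using 0 by (intro that[of 0 0]) auto
  next
    case False
    \<comment> \<open>By \<open>ee\<close> also \<open>e'\<close> is positive, so one factor
      \<open>x2\<close> can be extracted from \<open>x2 ^ e'\<close>.\<close>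
    define t where "t = q (m + 2) * x2 ^ (e' - 1)"
    have t: "x1 * x3 = x2 * t + r (m + 2)" "r (m + 2) = x2 * (- t) + x1 * x3"
      using False ee by (simp_all add: ex2 t_def power_eq_if)
    have "t \<in> L"
      unfolding t_def by (intro L(2) pow qr xL)
    obtain G where "G \<in> L" "(x1 * x3) ^ e = r (m + 2) ^ e + x2 * G"
      using binomial_mod[OF L(1,2) 0 1 xL(3) \<open>t \<in> L\<close> qr(2)[of "m + 2"], of e]
      unfolding t(1)[symmetric] by blast
    moreover obtain S where "S \<in> L" "r (m + 2) ^ e = (x1 * x3) ^ e + x2 * S"
      using binomial_mod[OF L(1,2) 0 1 xL(3) L(3)[OF \<open>t \<in> L\<close>] L(2)[OF xL(2,4)], of e]
      unfolding t(2)[symmetric] by blast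
    ultimately show ?thesis
      by (intro that)
  qed
  define H where "H = r (m + 3) * (1 / q (m + 1)) * x0 + q (m + 3) * G"
  have "x2 * (x4 * x1 ^ e) = x2 * x4 * x1 ^ e"
    by simp
  also have "\<dots> = q (m + 3) * (x1 * x3) ^ e + r (m + 3) * x1 ^ e"
    unfolding ex3 by (simp add: algebra_simps power_mult_distrib)
  also have "\<dots> = r (m + 3) / q (m + 1) * (q (m + 1) * x1 ^ e + r (m + 1)) + q (m + 3) * x2 * G"
    unfolding GS(3) distrib_left co by (simp add: ac_simps)
  also have "\<dots> = x2 * H"
    unfolding ex1[symmetric] H_def by (simp add: algebra_simps)
  finally have H: "x4 * x1 ^ e = H"
    using x2 by simp
  \<comment> \<open>\<open>GS(4)\<close> is the unit-ideal relation: it writes the invertible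
    \<open>r (m + 2) ^ e\<close> as a combination of \<open>x1 ^ e\<close> and
    \<open>x2\<close>.\<close>
  have "x4 * r (m + 2) ^ e = (x4 * x1 ^ e) * x3 ^ e + (x2 * x4) * S"
    unfolding GS(4) by (simp add: algebra_simps power_mult_distrib)
  also have "\<dots> = H * x3 ^ e + (q (m + 3) * x3 ^ e + r (m + 3)) * S"
    by (simp only: H ex3)
  finally have "x4 = (H * x3 ^ e + (q (m + 3) * x3 ^ e + r (m + 3)) * S) * (1 / r (m + 2) ^ e)"
    by (simp add: eq_divide_eq)
  moreover have "H \<in> L"
    unfolding H_def by (intro L(1,2) qr xL GS(1))
  then have "(H * x3 ^ e + (q (m + 3) * x3 ^ e + r (m + 3)) * S) * (1 / r (m + 2) ^ e) \<in> L"
    by (intro L(1,2) qr xL GS(2) pow)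
  ultimately show ?thesis
    by (simp add: x)
qed

lemma all_in_ring:
  assumes L: "\<And>f g. f \<in> L \<Longrightarrow> g \<in> L \<Longrightarrow> f + g \<in> L" "\<And>f g. f \<in> L \<Longrightarrow> g \<in> L \<Longrightarrow> f * g \<in> L"
    "\<And>f. f \<in> L \<Longrightarrow> - f \<in> L" and UL: "U \<subseteq> L"
    and yL: "y 0 \<in> L" "y 1 \<in> L" "y 2 \<in> L" "y 3 \<in> L"
  shows "y m \<in> L"
proof -
  interpret reflected: exchange_pattern b c U "\<lambda>m. q (- m)" "\<lambda>m. r (- m)" "\<lambda>m. y (- m)"
    by (rule reflect)
  have "y m \<in> L \<and> y (m + 1) \<in> L \<and> y (m + 2) \<in> L \<and> y (m + 3) \<in> L"
  proof (induction m rule: int_induct[where k = 0])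
    case base
    show ?case using yL by simp
  next
    case (step1 i)
    then have "y (i + 4) \<in> L"
      using ring_step[of L i] L UL by blast
    with step1 show ?case
      by (simp add: add.assoc)
  next
    case (step2 i)
    \<comment> \<open>In the reflected pattern the window starting at \<open>- i - 3\<close> runs
      through \<open>y (i + 3)\<close>, ..., \<open>y i\<close>, and the next variable is
      \<open>y (i - 1)\<close>.\<close>
    then have "y (i - 1) \<in> L"
      using reflected.ring_step[of L "- i - 3"] L UL by (simp add: algebra_simps)
    with step2 show ?case
      by (simp add: algebra_simps)
  qed
  then show ?thesis ..
qed

text \<open>The ratio of the two monomials in the exchange relation satisfies the coefficient-free Y-system.\<close>

definition yhat :: "int \<Rightarrow> 'k" where
  "yhat m = q m * y m ^ alt_exp b c m / r m"

lemma yhat_nonzero [simp]: "yhat m \<noteq> 0"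
  by (simp add: yhat_def)

lemma exchange_yhat: "y (m - 1) * y (m + 1) = r m * (1 + yhat m)"
  unfolding exchange yhat_def by (simp add: field_simps)

lemma yhat_add_1_nonzero [simp]: "1 + yhat m \<noteq> 0"
  by (metis exchange_yhat mult_eq_0_iff y_nonzero)

text \<open>The two neighbours share the exponent, so their product is a power of the left side of
  the exchange relation; the factor \<open>r m ^ ?e\<close> that this produces is absorbed by the
  coefficient relation.\<close>

lemma y_system: "yhat (m - 1) * yhat (m + 1) = (1 + yhat m) ^ alt_exp b c (m + 1)"
proof -
  let ?e = "alt_exp b c (m + 1)"
  have e: "alt_exp b c (m - 1) = ?e"
    by (simp add: alt_exp_def)
  have "yhat (m - 1) * yhat (m + 1) =
      q (m - 1) * q (m + 1) * (y (m - 1) * y (m + 1)) ^ ?e / (r (m - 1) * r (m + 1))"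
    by (simp add: yhat_def e power_mult_distrib)
  also have "\<dots> = (1 + yhat m) ^ ?e"
    unfolding exchange_yhat power_mult_distrib coeffs[symmetric] by simp
  finally show ?thesis .
qed

lemma y_skip: "y (m + 2) = r (m + 1) * (1 + yhat (m + 1)) / y m"
  using exchange_yhat[of "m + 1"] by (simp add: field_simps)

lemma y_skip_twice:
  "y (m + 4) / y m = r (m + 3) * (1 + yhat (m + 3)) / (r (m + 1) * (1 + yhat (m + 1)))"
  using y_skip[of m] y_skip[of "m + 2"] by (simp add: add.assoc)

end

section \<open>Y-systems of types \<open>A\<^sub>2\<close>, \<open>B\<^sub>2\<close>,
  \<open>G\<^sub>2\<close>, solved as rational functions of \<open>z0\<close> and
  \<open>z1\<close>\<close>

lemma y_system_A2:
  fixes z0 :: "'k::field"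
  assumes nz: "z0 \<noteq> 0" "z1 \<noteq> 0" "z2 \<noteq> 0" "z3 \<noteq> 0" "z4 \<noteq> 0" "z5 \<noteq> 0"
    and rel: "z0 * z2 = 1 + z1" "z1 * z3 = 1 + z2" "z2 * z4 = 1 + z3" "z3 * z5 = 1 + z4"
  shows "z5 = z0"
proof -
  have 2: "z2 = (1 + z1) / z0" using nz rel by (simp add: field_simps)
  have s: "1 + z1 \<noteq> 0" using nz rel(1) by auto
  have "z3 = (1 + z2) / z1" using nz rel by (simp add: field_simps)
  also have "\<dots> = (1 + z0 + z1) / (z0 * z1)"
    unfolding 2 using nz by (simp add: divide_simps)
  finally have 3: "z3 = (1 + z0 + z1) / (z0 * z1)" .
  have s': "1 + z0 + z1 \<noteq> 0" using nz(4) 3 by auto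
  have "z4 = (1 + z3) / z2" using nz rel by (simp add: field_simps)
  also have "1 + z3 = (1 + z0) * (1 + z1) / (z0 * z1)"
    using nz by (simp add: 3 field_simps)
  finally have "z4 = (1 + z0) * (1 + z1) / (z0 * z1) / z2" .
  then have 4: "z4 = (1 + z0) / z1" unfolding 2 using nz s by simp
  have "1 + z4 = (1 + z0 + z1) / z1"
    using nz by (simp add: 4 field_simps)
  moreover have "z5 = (1 + z4) / z3" using nz rel by (simp add: field_simps)
  ultimately have "z5 = (1 + z0 + z1) / z1 / ((1 + z0 + z1) / (z0 * z1))"
    by (simp only: 3)
  then show ?thesis
    using s' nz by simp
qed

text \<open>The first claim handles the indices with exponent 1. The second serves the indices with
  exponent 2, where \<open>z0\<close> is \<open>y ^ 2\<close> times a coefficient.\<close>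

lemma y_system_B2:
  fixes z0 :: "'k::field"
  assumes nz: "z0 \<noteq> 0" "z1 \<noteq> 0" "z2 \<noteq> 0" "z3 \<noteq> 0" "z4 \<noteq> 0" "z5 \<noteq> 0" "z6 \<noteq> 0"
    and rel: "z0 * z2 = (1 + z1) ^ 2" "z1 * z3 = 1 + z2" "z2 * z4 = (1 + z3) ^ 2" "z3 * z5 = 1 + z4"
      "z4 * z6 = (1 + z5) ^ 2" "z5 * z7 = 1 + z6"
  shows "z7 = z1" "(1 + z1) * (1 + z5) = (1 + z3) * z0"
proof -
  define s where "s = 1 + z1"
  \<comment> \<open>In terms of \<open>s\<close> the numerators factor, e.g.
    \<open>z0 * z1 + z0 + s ^ 2 = s * (z0 + s)\<close>, which makes the divisions cancel.\<close>
  have z1: "z1 = s - 1" by (simp add: s_def)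
  have s: "s \<noteq> 0" using nz rel(1) by (auto simp: s_def)
  have 2: "z2 = s ^ 2 / z0" using nz rel by (simp add: s_def field_simps)
  have "z3 = (1 + z2) / z1" using nz rel by (simp add: field_simps)
  also have "\<dots> = (z0 + s ^ 2) / (z0 * z1)"
    unfolding 2 using nz by (simp add: divide_simps)
  finally have 3: "z3 = (z0 + s ^ 2) / (z0 * z1)" .
  \<comment> \<open>Each factor cancelled later divides the numerator of some earlier
    \<open>z\<close>, so its nonvanishing is inherited from the hypotheses.\<close>
  have s2: "z0 + s ^ 2 \<noteq> 0" using nz(4) 3 by auto
  have "1 + z3 = (z0 * z1 + z0 + s ^ 2) / (z0 * z1)"
    using nz by (simp add: 3 field_simps)
  also have "z0 * z1 + z0 + s ^ 2 = s * (z0 + s)"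
    by (simp add: z1 algebra_simps power2_eq_square)
  finally have 33: "1 + z3 = s * (z0 + s) / (z0 * z1)" .
  have "z4 = (1 + z3) ^ 2 / z2" using nz rel by (simp add: field_simps)
  also have "\<dots> = (z0 + s) ^ 2 / (z0 * z1 ^ 2)"
    unfolding 2 33 using nz s by (simp add: divide_simps power2_eq_square)
  finally have 4: "z4 = (z0 + s) ^ 2 / (z0 * z1 ^ 2)" .
  have s1: "z0 + s \<noteq> 0" using nz(5) 4 by auto
  have "1 + z4 = (z0 * z1 ^ 2 + (z0 + s) ^ 2) / (z0 * z1 ^ 2)"
    using nz by (simp add: 4 field_simps)
  also have "z0 * z1 ^ 2 + (z0 + s) ^ 2 = (1 + z0) * (z0 + s ^ 2)"
    by (simp add: z1 algebra_simps power2_eq_square power3_eq_cube)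
  finally have 44: "1 + z4 = (1 + z0) * (z0 + s ^ 2) / (z0 * z1 ^ 2)" .
  have "z5 = (1 + z4) / z3" using nz rel by (simp add: field_simps)
  also have "\<dots> = (1 + z0) / z1"
    unfolding 44 3 using nz s2 by (simp add: divide_simps power2_eq_square)
  finally have 5: "z5 = (1 + z0) / z1" .
  have 55: "1 + z5 = (z0 + s) / z1"
    using nz by (simp add: 5 s_def field_simps)
  have "z6 = (1 + z5) ^ 2 / z4" using nz rel by (simp add: field_simps)
  also have "\<dots> = z0"
    unfolding 55 4 using nz s1 by (simp add: divide_simps power2_eq_square)
  finally have 6: "z6 = z0" .
  have "z7 = (1 + z6) / z5" using nz rel by (simp add: field_simps)
  moreover have "1 + z0 \<noteq> 0" using 5 nz by auto
  ultimately have "z7 = (1 + z0) / ((1 + z0) / z1)" "1 + z0 \<noteq> 0"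
    by (simp_all only: 6 5 not_False_eq_True)
  then show "z7 = z1"
    using nz by simp
  show "(1 + z1) * (1 + z5) = (1 + z3) * z0"
    using nz by (simp add: 33 55 flip: s_def)
qed

lemma y_system_G2:
  fixes z0 :: "'k::field"
  assumes nz: "z0 \<noteq> 0" "z1 \<noteq> 0" "z2 \<noteq> 0" "z3 \<noteq> 0" "z4 \<noteq> 0" "z5 \<noteq> 0" "z6 \<noteq> 0" "z7 \<noteq> 0" "z8 \<noteq> 0"
    and rel: "z0 * z2 = (1 + z1) ^ 3" "z1 * z3 = 1 + z2" "z2 * z4 = (1 + z3) ^ 3" "z3 * z5 = 1 + z4"
      "z4 * z6 = (1 + z5) ^ 3" "z5 * z7 = 1 + z6" "z6 * z8 = (1 + z7) ^ 3" "z7 * z9 = 1 + z8"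
  shows "z9 = z1" "(1 + z7) * (1 + z3) = (1 + z5) * (1 + z1)"
proof -
  define s where "s = 1 + z1"
  \<comment> \<open>The cofactor of \<open>z0 + s ^ 3\<close> in the numerator of
    \<open>1 + z4\<close>; it becomes the numerator of \<open>z5\<close> and returns as a factor in
    \<open>1 + z6\<close>.\<close>
  define p where "p = z0 ^ 2 + (3 * s - 1) * z0 + s ^ 3"
  have z1: "z1 = s - 1" by (simp add: s_def)
  have s: "s \<noteq> 0" using nz rel(1) by (auto simp: s_def)
  have 2: "z2 = s ^ 3 / z0" using nz rel by (simp add: s_def field_simps)
  have "z3 = (1 + z2) / z1" using nz rel by (simp add: field_simps)
  also have "\<dots> = (z0 + s ^ 3) / (z0 * z1)"
    unfolding 2 using nz by (simp add: divide_simps)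
  finally have 3: "z3 = (z0 + s ^ 3) / (z0 * z1)" .
  have s3: "z0 + s ^ 3 \<noteq> 0" using nz(4) 3 by auto
  have "1 + z3 = (z0 * z1 + z0 + s ^ 3) / (z0 * z1)"
    using nz by (simp add: 3 field_simps)
  also have "z0 * z1 + z0 + s ^ 3 = s * (z0 + s ^ 2)"
    by (simp add: z1 algebra_simps power2_eq_square power3_eq_cube)
  finally have 33: "1 + z3 = s * (z0 + s ^ 2) / (z0 * z1)" .
  have "z4 = (1 + z3) ^ 3 / z2" using nz rel by (simp add: field_simps)
  also have "\<dots> = (z0 + s ^ 2) ^ 3 / (z0 ^ 2 * z1 ^ 3)"
    unfolding 2 33 using nz s by (simp add: divide_simps power2_eq_square power3_eq_cube)
  finally have 4: "z4 = (z0 + s ^ 2) ^ 3 / (z0 ^ 2 * z1 ^ 3)" .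
  have s2: "z0 + s ^ 2 \<noteq> 0" using nz(5) 4 by auto
  have "1 + z4 = (z0 ^ 2 * z1 ^ 3 + (z0 + s ^ 2) ^ 3) / (z0 ^ 2 * z1 ^ 3)"
    using nz by (simp add: 4 field_simps)
  also have "z0 ^ 2 * z1 ^ 3 + (z0 + s ^ 2) ^ 3 = (z0 + s ^ 3) * p"
    by (simp add: z1 p_def algebra_simps power2_eq_square power3_eq_cube)
  finally have 44: "1 + z4 = (z0 + s ^ 3) * p / (z0 ^ 2 * z1 ^ 3)" .
  have "z5 = (1 + z4) / z3" using nz rel by (simp add: field_simps)
  also have "\<dots> = p / (z0 * z1 ^ 2)"
    unfolding 44 3 using nz s3 by (simp add: divide_simps power2_eq_square power3_eq_cube)
  finally have 5: "z5 = p / (z0 * z1 ^ 2)" .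
  have p: "p \<noteq> 0" using nz(6) 5 by auto
  have "1 + z5 = (z0 * z1 ^ 2 + p) / (z0 * z1 ^ 2)"
    using nz by (simp add: 5 divide_simps)
  also have "z0 * z1 ^ 2 + p = (z0 + s) * (z0 + s ^ 2)"
    by (simp add: z1 p_def algebra_simps power2_eq_square power3_eq_cube)
  finally have 55: "1 + z5 = (z0 + s) * (z0 + s ^ 2) / (z0 * z1 ^ 2)" .
  have "z6 = (1 + z5) ^ 3 / z4" using nz rel by (simp add: field_simps)
  also have "\<dots> = (z0 + s) ^ 3 / (z0 * z1 ^ 3)"
    unfolding 55 4 using nz s2 by (simp add: divide_simps power_mult_distrib) (simp add: eval_nat_numeral algebra_simps)
  finally have 6: "z6 = (z0 + s) ^ 3 / (z0 * z1 ^ 3)" .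
  have s1: "z0 + s \<noteq> 0" using nz(7) 6 by auto
  have "1 + z6 = (z0 * z1 ^ 3 + (z0 + s) ^ 3) / (z0 * z1 ^ 3)"
    using nz by (simp add: 6 divide_simps)
  also have "z0 * z1 ^ 3 + (z0 + s) ^ 3 = (1 + z0) * p"
    by (simp add: z1 p_def algebra_simps power2_eq_square power3_eq_cube)
  finally have 66: "1 + z6 = (1 + z0) * p / (z0 * z1 ^ 3)" .
  have "z7 = (1 + z6) / z5" using nz rel by (simp add: field_simps)
  also have "\<dots> = (1 + z0) / z1"
    unfolding 66 5 using nz p by (simp add: divide_simps power2_eq_square power3_eq_cube)
  finally have 7: "z7 = (1 + z0) / z1" .
  have 77: "1 + z7 = (z0 + s) / z1"
    using nz by (simp add: 7 s_def field_simps)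
  have "z8 = (1 + z7) ^ 3 / z6" using nz rel by (simp add: field_simps)
  also have "\<dots> = z0"
    unfolding 77 6 using nz s1 by (simp add: divide_simps power3_eq_cube)
  finally have 8: "z8 = z0" .
  have "z9 = (1 + z8) / z7" using nz rel by (simp add: field_simps)
  moreover have "1 + z0 \<noteq> 0" using 7 nz by auto
  ultimately have "z9 = (1 + z0) / ((1 + z0) / z1)" "1 + z0 \<noteq> 0"
    by (simp_all only: 8 7 not_False_eq_True)
  then show "z9 = z1"
    using nz by simp
  show "(1 + z7) * (1 + z3) = (1 + z5) * (1 + z1)"
    unfolding 77 33 55 s_def[symmetric] using nz by (simp add: divide_simps power2_eq_square)
qed

section \<open>Periodicity of the cluster variables up to coefficients\<close>

context exchange_pattern
begin

text \<open>With exponent 1, \<open>yhat\<close> is \<open>y\<close> times a coefficient and can be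
  solved for \<open>y\<close>; a higher exponent would give only a power of the ratio.\<close>

lemma ratio_in_U:
  assumes "alt_exp b c m = 1" "alt_exp b c (m + k) = 1" "yhat (m + k) = yhat m"
  shows "y (m + k) / y m \<in> U"
proof -
  have "y (m + k) / y m = r (m + k) / q (m + k) * (q m / r m)"
    using assms by (simp add: yhat_def field_simps)
  then show ?thesis
    using U_mult U_divide q_U r_U by metis
qed

lemma y_system_at: "yhat m * yhat (m + 2) = (1 + yhat (m + 1)) ^ alt_exp b c m"
  using y_system[of "m + 1"] by (simp add: alt_exp_def algebra_simps)

text \<open>With exponent 0, \<open>yhat\<close> is itself the coefficient \<open>q / r\<close>, and
  the Y-system makes the values at distance two mutually inverse.\<close>

lemma periodic_A1A1: "b = 0 \<Longrightarrow> y (m + 4) / y m \<in> U"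
proof -
  assume "b = 0"
  with exponents have 0: "alt_exp b c m = 0" for m by (simp add: alt_exp_def)
  have "1 + yhat (m + 3) = (1 + yhat (m + 1)) / yhat (m + 1)"
    using y_system_at[of "m + 1"] by (simp add: 0 field_simps add.assoc)
  moreover have "y (m + 4) = r (m + 3) * (1 + yhat (m + 3)) / y (m + 2)"
    using y_skip[of "m + 2"] by (simp add: add.assoc)
  ultimately have "y (m + 4) / y m = r (m + 3) / q (m + 1)"
    by (simp add: y_skip[of m]) (simp add: yhat_def 0)
  then show ?thesis
    by (simp add: U_divide q_U r_U)
qed

lemma periodic_A2:
  assumes "b = 1" "c = 1"
  shows "y (m + 5) / y m \<in> U"
proof -
  have e: "alt_exp b c k = 1" for k
    by (simp add: alt_exp_def assms)
  have rel: "yhat k * yhat (k + 2) = 1 + yhat (k + 1)" for k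
    using y_system_at[of k] by (simp add: e)
  have "yhat (m + 5) = yhat m"
    by (rule y_system_A2[of _ "yhat (m + 1)" "yhat (m + 2)" "yhat (m + 3)" "yhat (m + 4)"])
      (use rel[of m] rel[of "m + 1"] rel[of "m + 2"] rel[of "m + 3"] in \<open>simp_all add: add.assoc\<close>)
  then show ?thesis
    by (intro ratio_in_U e)
qed

text \<open>Odd indices have exponent 1 and follow from \<open>ratio_in_U\<close>. At an even
  \<open>k\<close> the product formula for \<open>y (k + 6) / y k\<close> leaves
  \<open>yhat k / y k ^ 2\<close>, which is the coefficient \<open>q k / r k\<close>.\<close>

lemma periodic_B2:
  assumes "b = 1" "c = 2"
  shows "y (m + 6) / y m \<in> U"
proof -
  have rel: "yhat k * yhat (k + 2) = (if odd k then 1 + yhat (k + 1) else (1 + yhat (k + 1)) ^ 2)" for k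
    using y_system_at[of k] by (simp add: alt_exp_def assms)
  have "y (k + 7) / y (k + 1) \<in> U" "y (k + 6) / y k \<in> U" if "even k" for k
  proof -
    have *: "yhat (k + 7) = yhat (k + 1)" "(1 + yhat (k + 1)) * (1 + yhat (k + 5)) = (1 + yhat (k + 3)) * yhat k"
      by (rule y_system_B2[of _ "yhat (k + 1)" "yhat (k + 2)" "yhat (k + 3)" "yhat (k + 4)" "yhat (k + 5)" "yhat (k + 6)"];
        (use that rel[of k] rel[of "k + 1"] rel[of "k + 2"] rel[of "k + 3"] rel[of "k + 4"] rel[of "k + 5"] in \<open>simp add: add.assoc\<close>))+
    show "y (k + 7) / y (k + 1) \<in> U"
      using ratio_in_U[of "k + 1" 6] *(1) that by (simp add: alt_exp_def assms add.assoc)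
    have "y (k + 6) / y k = r (k + 5) * r (k + 1) / r (k + 3) *
        ((1 + yhat (k + 1)) * (1 + yhat (k + 5)) / (1 + yhat (k + 3))) / y k ^ 2"
    proof -
      have "y (k + 6) / y k = y (k + 2 + 4) / y (k + 2) * y (k + 2) / y k"
        by (simp add: add.assoc)
      also have "\<dots> = r (k + 5) * (1 + yhat (k + 5)) / (r (k + 3) * (1 + yhat (k + 3))) *
          (r (k + 1) * (1 + yhat (k + 1)) / y k) / y k"
        unfolding y_skip_twice unfolding y_skip[of k] by (simp add: add.assoc)
      also have "\<dots> = r (k + 5) * r (k + 1) / r (k + 3) *
          ((1 + yhat (k + 1)) * (1 + yhat (k + 5)) / (1 + yhat (k + 3))) / y k ^ 2"
        by (simp add: power2_eq_square mult_ac)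
      finally show ?thesis .
    qed
    also have "\<dots> = r (k + 5) * r (k + 1) / r (k + 3) * (yhat k / y k ^ 2)"
      unfolding *(2) by simp
    also have "yhat k / y k ^ 2 = q k / r k"
      unfolding yhat_def alt_exp_def using that assms by simp
    finally show "y (k + 6) / y k \<in> U"
      by (simp add: U_divide U_mult q_U r_U)
  qed
  from this(2)[of m] this(1)[of "m - 1"] show ?thesis
    by (cases "even m") (simp_all add: add.commute)
qed

text \<open>At an even \<open>k\<close>, two double skips express \<open>y (k + 8) / y k\<close> by
  four factors \<open>1 + yhat\<close>, which cancel by the second identity of
  \<open>y_system_G2\<close>.\<close>

lemma periodic_G2:
  assumes "b = 1" "c = 3"
  shows "y (m + 8) / y m \<in> U"
proof -
  have rel: "yhat k * yhat (k + 2) = (if odd k then 1 + yhat (k + 1) else (1 + yhat (k + 1)) ^ 3)" for k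
    using y_system_at[of k] by (simp add: alt_exp_def assms)
  have "y (k + 9) / y (k + 1) \<in> U" "y (k + 8) / y k \<in> U" if "even k" for k
  proof -
    have *: "yhat (k + 9) = yhat (k + 1)"
      "(1 + yhat (k + 7)) * (1 + yhat (k + 3)) = (1 + yhat (k + 5)) * (1 + yhat (k + 1))"
      by (rule y_system_G2[of "yhat k" "yhat (k + 1)" "yhat (k + 2)" "yhat (k + 3)" "yhat (k + 4)" "yhat (k + 5)"
          "yhat (k + 6)" "yhat (k + 7)" "yhat (k + 8)"];
        (use that rel[of k] rel[of "k + 1"] rel[of "k + 2"] rel[of "k + 3"] rel[of "k + 4"] rel[of "k + 5"]
          rel[of "k + 6"] rel[of "k + 7"] in \<open>simp add: add.assoc\<close>))+
    show "y (k + 9) / y (k + 1) \<in> U"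
      using ratio_in_U[of "k + 1" 8] *(1) that by (simp add: alt_exp_def assms add.assoc)
    have "y (k + 8) / y k = r (k + 7) * r (k + 3) / (r (k + 5) * r (k + 1)) *
        ((1 + yhat (k + 7)) * (1 + yhat (k + 3)) / ((1 + yhat (k + 5)) * (1 + yhat (k + 1))))"
    proof -
      have "y (k + 8) / y k = y (k + 4 + 4) / y (k + 4) * (y (k + 4) / y k)"
        by (simp add: add.assoc)
      then show ?thesis
        unfolding y_skip_twice by (simp add: add.assoc mult.commute mult.left_commute)
    qed
    also have "\<dots> = r (k + 7) * r (k + 3) / (r (k + 5) * r (k + 1))"
      unfolding *(2) by simp
    finally show "y (k + 8) / y k \<in> U"
      by (simp add: U_divide U_mult q_U r_U)
  qed
  from this(2)[of m] this(1)[of "m - 1"] show ?thesis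
    by (cases "even m") (simp_all add: add.commute)
qed

end

lemma (in exchange_pattern) finite_type_periodic:
  assumes "(b, c, h) \<in> {(0, 0, 2), (1, 1, 3), (1, 2, 4), (2, 1, 4), (1, 3, 6), (3, 1, 6)}"
  shows "y (m + int h + 2) / y m \<in> U"
proof -
  interpret shifted: exchange_pattern c b U "\<lambda>m. q (m + 1)" "\<lambda>m. r (m + 1)" "\<lambda>m. y (m + 1)"
    by (rule shift)
  show ?thesis
    using assms periodic_A1A1[of m] periodic_A2[of m] periodic_B2[of m] periodic_G2[of m]
      shifted.periodic_B2[of "m - 1"] shifted.periodic_G2[of "m - 1"]
    by (elim insertE emptyE) (simp_all add: algebra_simps)
qed

lemma (in exchange_pattern) periodic_mod:
  assumes per: "\<And>m. y (m + N) / y m \<in> U" and "m mod N = n mod N"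
  shows "y m / y n \<in> U"
proof -
  have step: "y (m + int k * N) / y m \<in> U" for m k
  proof (induction k)
    case 0
    show ?case by (simp add: U_1)
  next
    case (Suc k)
    have "y (m + int (Suc k) * N) / y m = y (m + int k * N + N) / y (m + int k * N) * (y (m + int k * N) / y m)"
      by (simp add: algebra_simps)
    then show ?case
      using U_mult[OF per[of "m + int k * N"] Suc] by (simp only:)
  qed
  have main: "y m / y n \<in> U" if "m = n + int k * N" for m n k
    using step[of n k] that by simp
  obtain k where k: "m = n + k * N"
    using assms(2) by (metis mod_eqE add_diff_cancel_left' diff_add_cancel mult.commute add.commute)
  show ?thesis
  proof (cases "0 \<le> k")
    case True
    with k main[of m n "nat k"] show ?thesis by simp
  next
    case False
    with k main[of n m "nat (- k)"] have "y n / y m \<in> U" by simp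
    then show ?thesis
      using U_inverse by fastforce
  qed
qed

subsection \<open>Real roots of rank two\<close>

lemma simple_root_simps [simp]: "simple_root 1 = (1, 0)" "simple_root (Suc 0) = (1, 0)" "simple_root 2 = (0, 1)"
  by (simp_all add: simple_root_def)

lemma simple_refl_1: "simple_refl b c 1 (i, j) = (int b * j - i, j)"
  and simple_refl_2: "simple_refl b c 2 (i, j) = (i, int c * i - j)"
  by (simp_all add: simple_refl_def)

lemma ang_parity: "even m \<Longrightarrow> ang m = 2" "odd m \<Longrightarrow> ang m = 1"
  by (simp_all add: ang_def)

lemma ang_cases: "ang m = 1 \<or> ang m = 2"
  by (simp add: ang_def)

definition root1 :: "nat \<Rightarrow> nat \<Rightarrow> nat \<Rightarrow> int \<times> int" where
  "root1 b c m = w1 b c m (simple_root (ang (Suc m)))"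

definition root2 :: "nat \<Rightarrow> nat \<Rightarrow> nat \<Rightarrow> int \<times> int" where
  "root2 b c m = w2 b c m (simple_root (ang (Suc (Suc m))))"

text \<open>Linearity alone matters, so the entries stay anonymous.\<close>

lemma w1_linear: "\<exists>p q s t. \<forall>i j. w1 b c m (i, j) = (p * i + q * j, s * i + t * j)"
proof (induction m)
  case 0
  have "w1 b c 0 (i, j) = (1 * i + 0 * j, 0 * i + 1 * j)" for i j
    by simp
  then show ?case by blast
next
  case (Suc m)
  then obtain p q s t where *: "\<And>i j. w1 b c m (i, j) = (p * i + q * j, s * i + t * j)"
    by blast
  show ?case
  proof (cases "even m")
    case True
    then have "w1 b c (Suc m) (i, j) = ((- p) * i + (p * int b + q) * j, (- s) * i + (s * int b + t) * j)" for i j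
      by (simp add: ang_parity simple_refl_1[simplified] * algebra_simps)
    then show ?thesis by blast
  next
    case False
    then have "w1 b c (Suc m) (i, j) = ((p + q * int c) * i + (- q) * j, (s + t * int c) * i + (- t) * j)" for i j
      by (simp add: ang_parity simple_refl_2 * algebra_simps)
    then show ?thesis by blast
  qed
qed

text \<open>The parity is opposite to that of \<open>alt_exp\<close> because
  \<open>root1 b c m\<close> will be matched with \<open>\<delta> (m + 3)\<close>.\<close>

definition alt_coeff :: "nat \<Rightarrow> nat \<Rightarrow> nat \<Rightarrow> int" where
  "alt_coeff b c m = (if even m then int b else int c)"

lemma root1_0: "root1 b c 0 = (1, 0)"
  by (simp add: root1_def ang_def)

lemma root1_1: "root1 b c (Suc 0) = (int b, 1)"
  by (simp add: root1_def ang_def simple_refl_1[simplified])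

text \<open>For even \<open>m\<close>, apply \<open>w1 b c m\<close> to \<open>s\<^sub>1 s\<^sub>2
  \<alpha>\<^sub>1 = c s\<^sub>1 \<alpha>\<^sub>2 - \<alpha>\<^sub>1\<close>; odd \<open>m\<close>
  is symmetric.\<close>

lemma root1_rec:
  "fst (root1 b c (Suc (Suc m))) = alt_coeff b c (Suc m) * fst (root1 b c (Suc m)) - fst (root1 b c m)"
  "snd (root1 b c (Suc (Suc m))) = alt_coeff b c (Suc m) * snd (root1 b c (Suc m)) - snd (root1 b c m)"
proof -
  obtain p q s t where *: "\<And>i j. w1 b c m (i, j) = (p * i + q * j, s * i + t * j)"
    using w1_linear by blast
  show "fst (root1 b c (Suc (Suc m))) = alt_coeff b c (Suc m) * fst (root1 b c (Suc m)) - fst (root1 b c m)"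
    "snd (root1 b c (Suc (Suc m))) = alt_coeff b c (Suc m) * snd (root1 b c (Suc m)) - snd (root1 b c m)"
    by (cases "even m";
        simp add: root1_def alt_coeff_def ang_parity simple_refl_1[simplified] simple_refl_2 * algebra_simps)+
qed

lemma w2_swap: "w2 b c m v = prod.swap (w1 c b m (prod.swap v))"
proof (induction m arbitrary: v)
  case (Suc m)
  show ?case
    by (cases v; cases "even m"; simp add: Suc ang_parity simple_refl_1[simplified] simple_refl_2)
qed simp

lemma root2_swap: "root2 b c m = prod.swap (root1 c b m)"
  by (cases "even m") (simp_all add: root1_def root2_def w2_swap ang_parity)

text \<open>The words are defined by growth on the right; for the action of the reflections on roots
  they must grow on the left.\<close>

lemma w_Suc: "w1 b c (Suc m) = simple_refl b c 1 \<circ> w2 b c m" "w2 b c (Suc m) = simple_refl b c 2 \<circ> w1 b c m"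
proof (induction m)
  case 0
  {
    case 1
    show ?case by (simp add: ang_def)
  next
    case 2
    show ?case by (simp add: ang_def)
  }
next
  case (Suc m)
  {
    case 1
    have "w1 b c (Suc (Suc m)) = w1 b c (Suc m) \<circ> simple_refl b c (ang (Suc (Suc m)))"
      by simp
    also have "\<dots> = simple_refl b c 1 \<circ> w2 b c (Suc m)"
      unfolding Suc(1) by (simp add: comp_assoc)
    finally show ?case .
  next
    case 2
    have "w2 b c (Suc (Suc m)) = w2 b c (Suc m) \<circ> simple_refl b c (ang (Suc (Suc (Suc m))))"
      by simp
    also have "\<dots> = simple_refl b c 2 \<circ> w1 b c (Suc m)"
      unfolding Suc(2) by (simp add: comp_assoc ang_def)
    finally show ?case .
  }
qed

lemma simple_refl_involution: "i = 1 \<or> i = 2 \<Longrightarrow> simple_refl b c i (simple_refl b c i v) = v"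
  by (cases v) (auto simp: simple_refl_def)

lemma simple_refl_uminus: "simple_refl b c i (- v) = - simple_refl b c i v"
  by (cases v) (auto simp: simple_refl_def)

lemma simple_refl_simple_root: "i = 1 \<or> i = 2 \<Longrightarrow> simple_refl b c i (simple_root i) = - simple_root i"
  by (auto simp: simple_refl_def)

lemma w1_uminus: "w1 b c m (- v) = - w1 b c m v"
  by (induction m arbitrary: v) (simp_all add: simple_refl_uminus)

lemma w2_uminus: "w2 b c m (- v) = - w2 b c m v"
  by (induction m arbitrary: v) (simp_all add: simple_refl_uminus)

text \<open>Each reflection moves roots between the two sequences, shifting the index by one, and
  only the first member of one sequence changes sign.\<close>

lemma refl_root:
  "simple_refl b c 1 (root1 b c 0) = - root1 b c 0"
  "simple_refl b c 1 (root1 b c (Suc m)) = root2 b c m"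
  "simple_refl b c 2 (root1 b c m) = root2 b c (Suc m)"
  "simple_refl b c 2 (root2 b c 0) = - root2 b c 0"
  "simple_refl b c 2 (root2 b c (Suc m)) = root1 b c m"
  "simple_refl b c 1 (root2 b c m) = root1 b c (Suc m)"
proof -
  have a: "ang (Suc (Suc (Suc m))) = ang (Suc m)"
    by (simp add: ang_def)
  show "simple_refl b c 1 (root1 b c 0) = - root1 b c 0" "simple_refl b c 2 (root2 b c 0) = - root2 b c 0"
    by (simp_all add: root1_def root2_def ang_def simple_refl_def)
  show "simple_refl b c 1 (root1 b c (Suc m)) = root2 b c m" "simple_refl b c 2 (root1 b c m) = root2 b c (Suc m)"
    "simple_refl b c 2 (root2 b c (Suc m)) = root1 b c m" "simple_refl b c 1 (root2 b c m) = root1 b c (Suc m)"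
    unfolding root1_def root2_def w_Suc a by (simp_all only: o_apply simple_refl_involution simp_thms)
qed

section \<open>The Weyl group and its orbit of simple roots\<close>

lemma simple_refl_Bij: "i = 1 \<or> i = 2 \<Longrightarrow> simple_refl b c i \<in> carrier (BijGroup UNIV)"
  unfolding BijGroup_def Bij_def
  by (auto intro!: bij_betw_byWitness[where f' = "simple_refl b c i"] simp: simple_refl_involution)

lemma BijGroup_UNIV_mult:
  "f \<in> carrier (BijGroup UNIV) \<Longrightarrow> g \<in> carrier (BijGroup UNIV) \<Longrightarrow> f \<otimes>\<^bsub>BijGroup UNIV\<^esub> g = f \<circ> g"
  by (simp add: BijGroup_def compose_def fun_eq_iff)

lemma BijGroup_UNIV_one: "\<one>\<^bsub>BijGroup UNIV\<^esub> = id"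
  by (simp add: BijGroup_def fun_eq_iff)

lemma carrier_weyl_group:
  "carrier (weyl_group b c) = generate (BijGroup UNIV) {simple_refl b c 1, simple_refl b c 2}"
  using simple_refl_Bij[of 1 b c] simple_refl_Bij[of 2 b c]
  by (simp add: weyl_group_def carrier_subgroup_generated Int_absorb1)

lemma weyl_group_mult: "f \<otimes>\<^bsub>weyl_group b c\<^esub> g = f \<otimes>\<^bsub>BijGroup UNIV\<^esub> g"
  and weyl_group_one: "\<one>\<^bsub>weyl_group b c\<^esub> = id"
  by (simp_all add: weyl_group_def subgroup_generated_def BijGroup_UNIV_one)

lemma weyl_group_subset: "carrier (weyl_group b c) \<subseteq> carrier (BijGroup UNIV)"
  unfolding carrier_weyl_group
  by (rule group.generate_incl[OF group_BijGroup]) (use simple_refl_Bij in auto)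

lemma simple_refl_weyl_group: "i = 1 \<or> i = 2 \<Longrightarrow> simple_refl b c i \<in> carrier (weyl_group b c)"
  unfolding carrier_weyl_group by (auto intro: generate.incl)

lemma group_weyl_group: "group (weyl_group b c)"
  unfolding weyl_group_def by (rule group.group_subgroup_generated[OF group_BijGroup])

lemma comp_weyl_group:
  assumes "f \<in> carrier (weyl_group b c)" "g \<in> carrier (weyl_group b c)"
  shows "f \<circ> g \<in> carrier (weyl_group b c)"
  using monoid.m_closed[OF group.is_monoid[OF group_weyl_group] assms] assms weyl_group_subset
  by (simp add: weyl_group_mult BijGroup_UNIV_mult subset_iff)

lemma w_weyl_group: "w1 b c m \<in> carrier (weyl_group b c)" "w2 b c m \<in> carrier (weyl_group b c)"
proof (induction m)
  case 0
  have "id \<in> carrier (weyl_group b c)"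
    using monoid.one_closed[OF group.is_monoid[OF group_weyl_group]] by (simp add: weyl_group_one)
  then show "w1 b c 0 \<in> carrier (weyl_group b c)" "w2 b c 0 \<in> carrier (weyl_group b c)"
    by simp_all
next
  case (Suc m)
  then show "w1 b c (Suc m) \<in> carrier (weyl_group b c)" "w2 b c (Suc m) \<in> carrier (weyl_group b c)"
    unfolding w_Suc by (simp_all add: comp_weyl_group simple_refl_weyl_group)
qed

text \<open>The generators are involutions, so stability under them already includes their
  inverses.\<close>

lemma weyl_group_stable:
  assumes S: "\<And>v. v \<in> S \<Longrightarrow> simple_refl b c 1 v \<in> S" "\<And>v. v \<in> S \<Longrightarrow> simple_refl b c 2 v \<in> S"
    and w: "w \<in> carrier (weyl_group b c)" and v: "v \<in> S"
  shows "w v \<in> S"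
  using w v unfolding carrier_weyl_group
proof (induction arbitrary: v rule: generate.induct)
  case one
  then show ?case by (simp add: BijGroup_UNIV_one)
next
  case (incl h)
  with S show ?case by (metis insertE singletonD)
next
  case (inv h)
  have "inv\<^bsub>BijGroup UNIV\<^esub> h = h"
  proof (rule group.inv_equality[OF group_BijGroup])
    show h: "h \<in> carrier (BijGroup UNIV)"
      using inv simple_refl_Bij by blast
    show "h \<otimes>\<^bsub>BijGroup UNIV\<^esub> h = \<one>\<^bsub>BijGroup UNIV\<^esub>"
      unfolding BijGroup_UNIV_mult[OF h h] BijGroup_UNIV_one
      using inv by (intro ext) (metis comp_apply id_apply insertE simple_refl_involution singletonD)
  qed (use inv simple_refl_Bij in blast)
  with inv S show ?case by (metis insertE singletonD)
next
  case (eng h1 h2)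
  have "h1 \<in> carrier (BijGroup UNIV)" "h2 \<in> carrier (BijGroup UNIV)"
    using eng weyl_group_subset unfolding carrier_weyl_group by blast+
  with eng show ?case
    by (simp add: BijGroup_UNIV_mult)
qed

lemma root_real_root:
  "root1 b c m \<in> real_roots b c" "- root1 b c m \<in> real_roots b c"
  "root2 b c m \<in> real_roots b c" "- root2 b c m \<in> real_roots b c"
proof -
  have *: "w (simple_root (ang k)) \<in> real_roots b c" if "w \<in> carrier (weyl_group b c)" for w k
    using that ang_cases[of k] unfolding real_roots_def by blast
  show "root1 b c m \<in> real_roots b c" "root2 b c m \<in> real_roots b c"
    unfolding root1_def root2_def by (intro * w_weyl_group)+
  \<comment> \<open>One more letter reflects the simple root in itself and so supplies the
    sign.\<close>
  have "- root1 b c m = w1 b c (Suc m) (simple_root (ang (Suc m)))"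
    using ang_cases by (simp add: root1_def simple_refl_simple_root w1_uminus)
  then show "- root1 b c m \<in> real_roots b c"
    using *[OF w_weyl_group(1)] by metis
  have "- root2 b c m = w2 b c (Suc m) (simple_root (ang (Suc (Suc m))))"
    using ang_cases by (simp add: root2_def simple_refl_simple_root w2_uminus)
  then show "- root2 b c m \<in> real_roots b c"
    using *[OF w_weyl_group(2)] by metis
qed

lemma real_roots_subset:
  assumes S: "\<And>v. v \<in> S \<Longrightarrow> simple_refl b c 1 v \<in> S" "\<And>v. v \<in> S \<Longrightarrow> simple_refl b c 2 v \<in> S"
    and "(1, 0) \<in> S" "(0, 1) \<in> S"
  shows "real_roots b c \<subseteq> S"
  unfolding real_roots_def using weyl_group_stable[of S, OF S] assms(3,4) by auto

lemma real_roots_eq: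
  "real_roots b c =
    range (root1 b c) \<union> range (\<lambda>m. - root1 b c m) \<union> range (root2 b c) \<union> range (\<lambda>m. - root2 b c m)"
  (is "_ = ?S")
proof
  show "?S \<subseteq> real_roots b c"
    using root_real_root by auto
  have 1: "simple_refl b c i (root1 b c m) \<in> ?S" "simple_refl b c i (root2 b c m) \<in> ?S" if "i = 1 \<or> i = 2" for i m
    by (use that in \<open>cases m; auto simp: refl_root simp del: One_nat_def\<close>)+
  have neg: "- v \<in> ?S" if "v \<in> ?S" for v
    using that by auto
  have "simple_refl b c i v \<in> ?S" if "i = 1 \<or> i = 2" "v \<in> ?S" for i v
    using that(2)
    by (elim UnE rangeE)
      (simp_all only: simple_refl_uminus 1[OF that(1)] neg[OF 1(1)[OF that(1)]] neg[OF 1(2)[OF that(1)]])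
  moreover have "(1, 0) = root1 b c 0" "(0, 1) = root2 b c 0"
    by (simp_all add: root1_0 root2_swap)
  ultimately show "real_roots b c \<subseteq> ?S"
    by (intro real_roots_subset) (blast, blast, blast, blast)
qed

subsection \<open>The recursion for denominator vectors\<close>

definition nonneg :: "int \<times> int \<Rightarrow> bool" where
  "nonneg v \<longleftrightarrow> 0 \<le> fst v \<and> 0 \<le> snd v"

text \<open>The invariant is \<open>?e m * u m \<le> 2 * u (Suc m)\<close>. Since consecutive
  coefficients multiply to at least 4, it yields
  \<open>2 * u m \<le> ?e (Suc m) * u (Suc m)\<close>, so the subtracted term takes away at most
  half. The offset \<open>k\<close> lets the sequence start at any root.\<close>

lemma alt_recursion_pos:
  fixes u :: "nat \<Rightarrow> int"
  assumes bc: "4 \<le> b * c"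
    and rec: "\<And>m. u (Suc (Suc m)) = alt_coeff b c (k + Suc m) * u (Suc m) - u m"
    and u: "0 \<le> u 0" "0 < u 1" "alt_coeff b c k * u 0 \<le> 2 * u 1"
  shows "0 \<le> u m" "0 < u (Suc m)"
proof -
  let ?e = "\<lambda>m. alt_coeff b c (k + m)"
  have pos: "0 < b" "0 < c"
    using bc by (auto intro: Nat.gr0I)
  have e: "4 \<le> ?e (Suc m) * ?e m" "0 < ?e m" for m
  proof -
    have "4 \<le> int b * int c"
      using bc by (simp flip: of_nat_mult)
    then show "4 \<le> ?e (Suc m) * ?e m" "0 < ?e m"
      using pos by (auto simp: alt_coeff_def mult.commute)
  qed
  have "0 \<le> u m \<and> 0 < u (Suc m) \<and> ?e m * u m \<le> 2 * u (Suc m)"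
  proof (induction m)
    case 0
    then show ?case using u by simp
  next
    case (Suc m)
    have "4 * u m \<le> ?e (Suc m) * ?e m * u m"
      using Suc e[of m] by (intro mult_right_mono) auto
    also have "\<dots> \<le> ?e (Suc m) * (2 * u (Suc m))"
      unfolding mult.assoc using Suc e[of "Suc m"] by (intro mult_left_mono) auto
    finally have "?e (Suc m) * u (Suc m) \<le> 2 * u (Suc (Suc m))"
      by (simp add: rec)
    moreover have "0 < ?e (Suc m) * u (Suc m)"
      using Suc e[of "Suc m"] by (intro mult_pos_pos) auto
    ultimately show ?case
      using Suc by linarith
  qed
  then show "0 \<le> u m" "0 < u (Suc m)" by auto
qed

text \<open>The third bound applies the same recursion to the functional
  \<open>2 * fst - b * snd\<close>. It puts these roots on one side of a line, to separate them from
  the mirrored sequence \<open>root2\<close>.\<close>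

lemma root1_infinite:
  assumes "4 \<le> b * c"
  shows "0 < fst (root1 b c m)" "0 \<le> snd (root1 b c m)" "int b * snd (root1 b c m) < 2 * fst (root1 b c m)"
proof -
  have b: "0 < b" using assms by (auto intro: Nat.gr0I)
  \<comment> \<open>Strict positivity from \<open>alt_recursion_pos\<close> begins at index 1; index
    0 is read off directly.\<close>
  have "0 < fst (root1 b c (Suc m))" for m
    by (rule alt_recursion_pos(2)[OF assms, of "\<lambda>m. fst (root1 b c m)" 0])
      (use b in \<open>simp_all add: root1_rec root1_0 root1_1 alt_coeff_def\<close>)
  then show "0 < fst (root1 b c m)"
    by (cases m) (simp_all add: root1_0)
  show "0 \<le> snd (root1 b c m)"
    by (rule alt_recursion_pos(1)[OF assms, of "\<lambda>m. snd (root1 b c m)" 0])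
      (simp_all add: root1_rec root1_0 root1_1 alt_coeff_def)
  have "0 < 2 * fst (root1 b c (Suc m)) - int b * snd (root1 b c (Suc m))" for m
    by (rule alt_recursion_pos(2)[OF assms, of "\<lambda>m. 2 * fst (root1 b c m) - int b * snd (root1 b c m)" 0])
      (use b in \<open>simp_all add: root1_rec root1_0 root1_1 alt_coeff_def algebra_simps\<close>)
  then show "int b * snd (root1 b c m) < 2 * fst (root1 b c m)"
    by (cases m) (simp_all add: root1_0)
qed

text \<open>The cross product of consecutive roots is 1, so the slopes are strictly increasing.\<close>

lemma root1_inj:
  assumes "4 \<le> b * c"
  shows "inj (root1 b c)"
proof (rule linorder_injI)
  fix m n :: nat
  assume "m < n"
  then obtain k where n: "n = m + Suc k"
    using less_iff_Suc_add by auto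
  define u where "u i = fst (root1 b c m) * snd (root1 b c (m + i)) - snd (root1 b c m) * fst (root1 b c (m + i))" for i
  have "fst (root1 b c m) * snd (root1 b c (Suc m)) - snd (root1 b c m) * fst (root1 b c (Suc m)) = 1"
    by (induction m) (simp_all add: root1_rec root1_0 root1_1 algebra_simps)
  then have "u 0 = 0" "u 1 = 1"
    by (simp_all add: u_def)
  then have "0 < u (Suc k)"
    by (intro alt_recursion_pos(2)[OF assms, of u m]) (simp_all add: u_def root1_rec algebra_simps)
  then show "root1 b c m \<noteq> root1 b c n"
    by (auto simp: u_def n)
qed

locale denominator_recursion =
  fixes b c :: nat and \<delta> :: "int \<Rightarrow> int \<times> int"
  assumes d1: "\<delta> 1 = (- 1, 0)" and d2: "\<delta> 2 = (0, - 1)"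
    and rec_fst: "fst (\<delta> (m - 1)) + fst (\<delta> (m + 1)) = int (if odd m then b else c) * max (fst (\<delta> m)) 0"
    and rec_snd: "snd (\<delta> (m - 1)) + snd (\<delta> (m + 1)) = int (if odd m then b else c) * max (snd (\<delta> m)) 0"
begin

text \<open>The map \<open>3 - m\<close> exchanges the initial indices 1 and 2 and reverses parity,
  hence the swaps of coordinates and of \<open>b\<close> and \<open>c\<close>.\<close>

lemma reflect: "denominator_recursion c b (\<lambda>m. prod.swap (\<delta> (3 - m)))"
proof
  fix m :: int
  have "3 - (m - 1) = 3 - m + 1" "3 - (m + 1) = 3 - m - 1"
    by simp_all
  then show "fst (prod.swap (\<delta> (3 - (m - 1)))) + fst (prod.swap (\<delta> (3 - (m + 1))))
      = int (if odd m then c else b) * max (fst (prod.swap (\<delta> (3 - m)))) 0"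
    "snd (prod.swap (\<delta> (3 - (m - 1)))) + snd (prod.swap (\<delta> (3 - (m + 1))))
      = int (if odd m then c else b) * max (snd (prod.swap (\<delta> (3 - m)))) 0"
    using rec_fst[of "3 - m"] rec_snd[of "3 - m"] by (cases "even m"; simp)+
qed (simp_all add: d1 d2)

text \<open>The truncation takes effect at \<open>\<delta> 2\<close>, which gives
  \<open>\<delta> 3 = - \<delta> 1\<close>; afterwards nonnegativity makes \<open>max\<close> the
  identity. The bound \<open>h\<close> lets the same argument serve both cases.\<close>

lemma delta_root1:
  assumes "\<And>k. k < h \<Longrightarrow> nonneg (root1 b c k)" "m < h"
  shows "\<delta> (int m + 3) = root1 b c m"
  using assms(2)
proof (induction m rule: less_induct)
  case (less m)
  have d3: "\<delta> 3 = (1, 0)"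
    using rec_fst[of 2] rec_snd[of 2] by (simp add: d1 d2 prod_eq_iff)
  consider "m = 0" | "m = 1" | k where "m = Suc (Suc k)"
    by (metis One_nat_def not0_implies_Suc)
  then show ?case
  proof cases
    case 1
    then show ?thesis by (simp add: d3 root1_0)
  next
    case 2
    then show ?thesis
      using rec_fst[of 3] rec_snd[of 3] by (simp add: d2 d3 root1_1 prod_eq_iff)
  next
    case 3
    have *: "\<delta> (int k + 3) = root1 b c k" "\<delta> (int (Suc k) + 3) = root1 b c (Suc k)"
      by (rule less.IH; use less.prems 3 in simp)+
    have nn: "nonneg (root1 b c (Suc k))"
      using less.prems 3 by (intro assms(1)) simp
    have i: "int (Suc k) + 3 - 1 = int k + 3" "int (Suc k) + 3 + 1 = int m + 3"
      using 3 by simp_all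
    show ?thesis
      using rec_fst[of "int (Suc k) + 3"] rec_snd[of "int (Suc k) + 3"] nn
      unfolding i *
      by (auto simp: 3 prod_eq_iff root1_rec nonneg_def alt_coeff_def max_absorb1)
  qed
qed

lemma infinite_case:
  assumes "4 \<le> b * c"
  shows "\<delta> (int m + 3) = root1 b c m" "\<delta> (- int m) = root2 b c m"
proof -
  show "\<delta> (int m + 3) = root1 b c m"
    by (intro delta_root1[of "Suc m"])
      (auto simp: nonneg_def intro: less_imp_le root1_infinite[OF assms])
  interpret reflected: denominator_recursion c b "\<lambda>m. prod.swap (\<delta> (3 - m))"
    by (rule reflect)
  have cb: "4 \<le> c * b" using assms by (simp add: mult.commute)
  have "prod.swap (\<delta> (3 - (int m + 3))) = root1 c b m"
    by (intro reflected.delta_root1[of "Suc m"])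
      (auto simp: nonneg_def intro: less_imp_le root1_infinite[OF cb])
  then show "\<delta> (- int m) = root2 b c m"
    by (metis root2_swap swap_swap diff_add_cancel diff_diff_eq2 diff_self diff_0 add.commute minus_diff_eq add_diff_cancel_right')
qed

lemma index_cases:
  obtains "m = 1" | "m = 2" | k where "m = int k + 3" | k where "m = - int k"
proof -
  consider "m = 1" | "m = 2" | "m \<ge> 3" | "m \<le> 0" by linarith
  then show ?thesis
    by cases (use that(1,2) that(3)[of "nat (m - 3)"] that(4)[of "nat (- m)"] in auto)
qed

lemma infinite_inj:
  assumes "4 \<le> b * c"
  shows "inj \<delta>"
proof (rule injI)
  have cb: "4 \<le> c * b" using assms by (simp add: mult.commute)
  note r = root1_infinite[OF assms] root1_infinite[OF cb]
  have pos: "0 < b" using assms by (auto intro: Nat.gr0I)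
  have cross: "root1 b c k \<noteq> root2 b c l" for k l
  proof
    assume eq: "root1 b c k = root2 b c l"
    define v where "v = root1 b c k"
    have v: "int b * snd v < 2 * fst v" "int c * fst v < 2 * snd v" "0 < fst v"
      using r(3)[of k] r(6)[of l] r(1)[of k] eq by (auto simp: v_def root2_swap)
    \<comment> \<open>The two separating inequalities, together with \<open>b * c \<ge> 4\<close>,
      give \<open>4 * fst v < 4 * fst v\<close>.\<close>
    have "4 * fst v \<le> int b * int c * fst v"
      using assms v(3) by (intro mult_right_mono) (simp_all flip: of_nat_mult)
    also have "\<dots> \<le> int b * (2 * snd v)"
      unfolding mult.assoc using v(2) by (intro mult_left_mono) auto
    finally show False using v(1) by simp
  qed
  have nn: "nonneg (root1 b c k)" "nonneg (root2 b c k)" for k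
    using r[of k] by (auto simp: nonneg_def root2_swap)
  have neg: "root1 b c k \<noteq> (- 1, 0)" "root1 b c k \<noteq> (0, - 1)"
    "root2 b c k \<noteq> (- 1, 0)" "root2 b c k \<noteq> (0, - 1)" for k
    using nn[of k] by (auto simp: nonneg_def)
  have inj: "root1 b c k = root1 b c l \<longleftrightarrow> k = l" "root2 b c k = root2 b c l \<longleftrightarrow> k = l" for k l
    using root1_inj[OF assms] root1_inj[OF cb] unfolding root2_swap inj_def by (auto simp: inj_eq)
  fix m n
  assume "\<delta> m = \<delta> n"
  then show "m = n"
    by (cases m rule: index_cases; cases n rule: index_cases;
        simp add: infinite_case[OF assms] d1 d2 neg neg[symmetric] cross cross[symmetric] inj)
qed

lemma infinite_range:
  assumes "4 \<le> b * c"
  shows "range \<delta> = {- simple_root 1, - simple_root 2} \<union> pos_real_roots b c"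
proof -
  have cb: "4 \<le> c * b" using assms by (simp add: mult.commute)
  note r = root1_infinite[OF assms] root1_infinite[OF cb]
  have "pos_real_roots b c = range (root1 b c) \<union> range (root2 b c)"
    using r(2,5) less_imp_le[OF r(1)] less_imp_le[OF r(4)] r(1,4)[unfolded not_le[symmetric]]
    unfolding pos_real_roots_def real_roots_eq by (auto simp: root2_swap)
  moreover have "range \<delta> = {\<delta> 1, \<delta> 2} \<union> range (root1 b c) \<union> range (root2 b c)" (is "_ = ?R")
  proof
    show "range \<delta> \<subseteq> ?R"
    proof (rule image_subsetI)
      fix m
      show "\<delta> m \<in> ?R"
        by (cases m rule: index_cases) (auto simp: infinite_case[OF assms])
    qed
    show "?R \<subseteq> range \<delta>"
      by (auto simp flip: infinite_case[OF assms])
  qed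
  ultimately show ?thesis
    by (auto simp: d1 d2)
qed

lemma finite_case:
  assumes nn: "\<And>m. m < h \<Longrightarrow> nonneg (root1 b c m)"
    and inj: "inj_on (root1 b c) {..<h}"
    and F: "F = root1 b c ` {..<h} \<union> (\<lambda>m. - root1 b c m) ` {..<h}"
    and stable: "\<And>v. v \<in> F \<Longrightarrow> simple_refl b c 1 v \<in> F" "\<And>v. v \<in> F \<Longrightarrow> simple_refl b c 2 v \<in> F"
    and basis: "(1, 0) \<in> F" "(0, 1) \<in> F"
    and nz: "(0, 0) \<notin> F"
    and period: "\<And>m. \<delta> (m + int h + 2) = \<delta> m"
  shows "range \<delta> = {- simple_root 1, - simple_root 2} \<union> pos_real_roots b c"
    and "\<delta> m = \<delta> n \<Longrightarrow> m mod (int h + 2) = n mod (int h + 2)"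
proof -
  have root: "\<delta> (int m + 3) = root1 b c m" if "m < h" for m
    using delta_root1[OF nn that] .
  define N where "N = int h + 2"
  have "\<delta> (m + int k * N) = \<delta> m" for m k
  proof (induction k)
    case (Suc k)
    then show ?case
      using period[of "m + int k * N"] by (simp add: N_def algebra_simps)
  qed simp
  note per = this
  have per': "\<delta> m = \<delta> (m + k * N)" for m k
    using per[of m "nat k"] per[of "m + k * N" "nat (- k)"] by (cases "0 \<le> k") simp_all
  have red: "\<exists>k. \<delta> m = \<delta> k \<and> k mod N = m mod N \<and> 1 \<le> k \<and> k \<le> N" for m
  proof -
    \<comment> \<open>The shift by one places representatives in 1, ..., \<open>N\<close>: the two
      negative simple roots followed by exactly \<open>h\<close> positive roots.\<close>
    define k where "k = (m - 1) mod N + 1"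
    have "k = m + (- ((m - 1) div N)) * N"
      by (simp add: k_def minus_div_mult_eq_mod[symmetric])
    then have "\<delta> m = \<delta> k" "k mod N = m mod N"
      using per'[of m "- ((m - 1) div N)"] by (simp_all only: mod_mult_self1)
    moreover have "1 \<le> k" "k \<le> N"
      by (simp_all add: k_def N_def add_pos_pos zless_imp_add1_zle)
    ultimately show ?thesis by blast
  qed
  have idx: "m = 1 \<or> m = 2 \<or> (\<exists>i<h. m = int i + 3)" if "1 \<le> m" "m \<le> N" for m
  proof -
    have "m = 1 \<or> m = 2 \<or> (nat (m - 3) < h \<and> m = int (nat (m - 3)) + 3)"
      using that by (auto simp: N_def)
    then show ?thesis by blast
  qed
  have neg: "\<not> nonneg (\<delta> 1)" "\<not> nonneg (\<delta> 2)" "\<delta> 1 \<noteq> \<delta> 2"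
    by (simp_all add: d1 d2 nonneg_def)
  have dinj: "m = n" if "1 \<le> m" "m \<le> N" "1 \<le> n" "n \<le> N" "\<delta> m = \<delta> n" for m n
    using idx[OF that(1,2)] idx[OF that(3,4)] that(5) neg nn inj_onD[OF inj]
    by (elim disjE exE conjE) (force simp: root)+
  show "m mod (int h + 2) = n mod (int h + 2)" if "\<delta> m = \<delta> n"
    using red[of m] red[of n] dinj that unfolding N_def by metis
  have "real_roots b c = F"
    using real_roots_subset[of F b c, OF stable basis] root_real_root unfolding F by auto
  moreover have "\<not> nonneg (- root1 b c m)" if "m < h" for m
    using nn[OF that] nz that unfolding F nonneg_def
    by (metis (no_types, lifting) UnI1 fst_uminus snd_uminus image_eqI lessThan_iff neg_0_le_iff_le order_antisym prod.collapse)
  ultimately have "pos_real_roots b c = root1 b c ` {..<h}"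
    using nn unfolding pos_real_roots_def F nonneg_def by auto
  moreover have "range \<delta> = {\<delta> 1, \<delta> 2} \<union> root1 b c ` {..<h}" (is "_ = ?R")
  proof
    show "range \<delta> \<subseteq> ?R"
    proof (rule image_subsetI)
      fix m
      obtain k where "\<delta> m = \<delta> k" "1 \<le> k" "k \<le> N" using red by blast
      then show "\<delta> m \<in> ?R"
        using idx[of k] root by auto
    qed
    show "?R \<subseteq> range \<delta>"
      by (auto simp flip: root)
  qed
  ultimately show "range \<delta> = {- simple_root 1, - simple_root 2} \<union> pos_real_roots b c"
    by (auto simp: d1 d2)
qed

end

subsection \<open>Coxeter numbers\<close>

lemma pow_weyl_group:
  assumes "f \<in> carrier (weyl_group b c)"
  shows "f [^]\<^bsub>weyl_group b c\<^esub> n = f ^^ n"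
proof (induction n)
  case 0
  show ?case by (simp add: weyl_group_one)
next
  case (Suc n)
  interpret group "weyl_group b c" by (rule group_weyl_group)
  have "f [^]\<^bsub>weyl_group b c\<^esub> n \<in> carrier (weyl_group b c)"
    using assms by simp
  then have "f [^]\<^bsub>weyl_group b c\<^esub> Suc n = (f [^]\<^bsub>weyl_group b c\<^esub> n) \<circ> f"
    using assms weyl_group_subset[of b c]
    unfolding nat_pow_Suc weyl_group_mult by (intro BijGroup_UNIV_mult) auto
  then show ?case
    by (simp only: Suc funpow_Suc_right)
qed

lemma w1_even: "w1 b c (2 * n) = (simple_refl b c 1 \<circ> simple_refl b c 2) ^^ n"
proof (induction n)
  case (Suc n)
  have "w1 b c (2 * Suc n) = w1 b c (2 * n) \<circ> (simple_refl b c 1 \<circ> simple_refl b c 2)"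
    by (simp add: ang_def comp_assoc)
  then show ?case
    by (simp only: Suc funpow_Suc_right)
qed simp

text \<open>The order divides \<open>h\<close>, so excluding proper divisors suffices, and one moved
  vector excludes each. Conversely, linearity lets two basis vectors certify that the
  \<open>h\<close>-th power is the identity.\<close>

lemma coxeter_number_eqI:
  assumes "((simple_refl b c 1 \<circ> simple_refl b c 2) ^^ h) (1, 0) = (1, 0)"
    and "((simple_refl b c 1 \<circ> simple_refl b c 2) ^^ h) (0, 1) = (0, 1)"
    and "\<And>k. k dvd h \<Longrightarrow> k \<noteq> h \<Longrightarrow> ((simple_refl b c 1 \<circ> simple_refl b c 2) ^^ k) (1, 0) \<noteq> (1, 0)"
  shows "coxeter_number b c = h"
proof -
  interpret group "weyl_group b c" by (rule group_weyl_group)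
  define f where "f = simple_refl b c 1 \<circ> simple_refl b c 2"
  obtain p q s t where lin: "\<And>i j. (f ^^ h) (i, j) = (p * i + q * j, s * i + t * j)"
    using w1_linear[of b c "2 * h"] unfolding w1_even f_def[symmetric] by blast
  have "(f ^^ h) (i, j) = (i, j)" for i j
    using assms(1,2) unfolding f_def[symmetric] by (simp add: lin)
  then have id: "f ^^ h = id"
    by (simp add: fun_eq_iff)
  have f: "f \<in> carrier (weyl_group b c)"
    unfolding f_def by (intro comp_weyl_group simple_refl_weyl_group) auto
  have "simple_refl b c 1 \<otimes>\<^bsub>weyl_group b c\<^esub> simple_refl b c 2 = f"
    unfolding weyl_group_mult f_def by (intro BijGroup_UNIV_mult simple_refl_Bij) auto
  then have h: "coxeter_number b c = ord f"
    by (simp add: coxeter_number_def)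
  have "ord f dvd h"
    using id pow_eq_id[OF f, of h] by (simp only: pow_weyl_group[OF f] weyl_group_one simp_thms)
  moreover have "f ^^ ord f = id"
    using pow_ord_eq_1[OF f] by (simp only: pow_weyl_group[OF f] weyl_group_one)
  ultimately show ?thesis
    using assms(3) unfolding h f_def by (metis id_apply)
qed

subsection \<open>Finite types\<close>

lemma root1_Suc_Suc:
  "root1 b c (Suc (Suc m)) =
    (alt_coeff b c (Suc m) * fst (root1 b c (Suc m)) - fst (root1 b c m),
     alt_coeff b c (Suc m) * snd (root1 b c (Suc m)) - snd (root1 b c m))"
  by (simp add: prod_eq_iff root1_rec)

lemma finite_type_cases:
  fixes b c :: nat
  assumes "(0 < b \<and> 0 < c) \<or> (b = 0 \<and> c = 0)" "b * c \<le> 3"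
  obtains "b = 0" "c = 0" | "b = 1" "c = 1" | "b = 1" "c = 2" | "b = 2" "c = 1" | "b = 1" "c = 3" | "b = 3" "c = 1"
proof -
  have "b \<le> 3" "c \<le> 3"
    using assms by (cases b; cases c; simp)+
  then have "b \<in> {0, 1, 2, 3}" "c \<in> {0, 1, 2, 3}"
    by auto
  then show ?thesis
    using assms that by auto
qed

lemma funpow_small:
  "f ^^ 2 = f \<circ> f" "f ^^ 3 = f \<circ> f \<circ> f" "f ^^ 4 = f \<circ> f \<circ> f \<circ> f" "f ^^ 6 = f \<circ> f \<circ> f \<circ> f \<circ> f \<circ> f"
  by (simp_all add: eval_nat_numeral fun_eq_iff)

text \<open>The positive roots of \<open>A\<^sub>1 \<times> A\<^sub>1\<close>,
  \<open>A\<^sub>2\<close>, \<open>B\<^sub>2\<close>, \<open>G\<^sub>2\<close> in the order of the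
  recursion; with these lists stability under reflections is a finite check.\<close>

lemma root1_list:
  "map (root1 0 0) [0..<2] = [(1, 0), (0, 1)]"
  "map (root1 1 1) [0..<3] = [(1, 0), (1, 1), (0, 1)]"
  "map (root1 1 2) [0..<4] = [(1, 0), (1, 1), (1, 2), (0, 1)]"
  "map (root1 2 1) [0..<4] = [(1, 0), (2, 1), (1, 1), (0, 1)]"
  "map (root1 1 3) [0..<6] = [(1, 0), (1, 1), (2, 3), (1, 2), (1, 3), (0, 1)]"
  "map (root1 3 1) [0..<6] = [(1, 0), (3, 1), (2, 1), (3, 2), (1, 1), (0, 1)]"
proof -
  have 2: "root1 b c 2 = (alt_coeff b c 1 * int b - 1, alt_coeff b c 1)" for b c
    by (simp add: eval_nat_numeral root1_Suc_Suc root1_0 root1_1)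
  have rec: "root1 b c (Suc (Suc m)) = (alt_coeff b c (Suc m) * x' - x, alt_coeff b c (Suc m) * y' - y)"
    if "root1 b c m = (x, y)" "root1 b c (Suc m) = (x', y')" for b c m x y x' y'
    by (simp add: root1_Suc_Suc that)
  have val: "root1 b c 0 = (1, 0)" "root1 b c 1 = (int b, 1)" for b c
    by (simp_all add: root1_0 root1_1)
  have 3: "root1 b c 3 = (alt_coeff b c 2 * x' - x, alt_coeff b c 2 * y' - y)"
    if "root1 b c 1 = (x, y)" "root1 b c 2 = (x', y')" for b c x y x' y'
    using rec[of b c 1 x y x' y'] that by (simp add: numeral_2_eq_2 numeral_3_eq_3)
  have 4: "root1 b c 4 = (alt_coeff b c 3 * x' - x, alt_coeff b c 3 * y' - y)"
    if "root1 b c 2 = (x, y)" "root1 b c 3 = (x', y')" for b c x y x' y'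
    using rec[of b c 2 x y x' y'] that by (simp add: eval_nat_numeral)
  have 5: "root1 b c 5 = (alt_coeff b c 4 * x' - x, alt_coeff b c 4 * y' - y)"
    if "root1 b c 3 = (x, y)" "root1 b c 4 = (x', y')" for b c x y x' y'
    using rec[of b c 3 x y x' y'] that by (simp add: eval_nat_numeral)
  have upt: "[0..<2] = [0, 1::nat]" "[0..<3] = [0, 1, 2::nat]" "[0..<4] = [0, 1, 2, 3::nat]"
    "[0..<6] = [0, 1, 2, 3, 4, 5::nat]"
    by (simp_all add: upt_rec)
  show "map (root1 0 0) [0..<2] = [(1, 0), (0, 1)]"
    unfolding upt by (simp add: val[simplified])
  show "map (root1 1 1) [0..<3] = [(1, 0), (1, 1), (0, 1)]"
    unfolding upt by (simp add: val[simplified] 2[simplified] alt_coeff_def)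
  show "map (root1 1 2) [0..<4] = [(1, 0), (1, 1), (1, 2), (0, 1)]"
    unfolding upt by (simp add: val[simplified] 2[simplified] 3[simplified] alt_coeff_def)
  show "map (root1 2 1) [0..<4] = [(1, 0), (2, 1), (1, 1), (0, 1)]"
    unfolding upt by (simp add: val[simplified] 2[simplified] 3[simplified] alt_coeff_def)
  show "map (root1 1 3) [0..<6] = [(1, 0), (1, 1), (2, 3), (1, 2), (1, 3), (0, 1)]"
    unfolding upt by (simp add: val[simplified] 2[simplified] 3[simplified] 4 5 alt_coeff_def)
  show "map (root1 3 1) [0..<6] = [(1, 0), (3, 1), (2, 1), (3, 2), (1, 1), (0, 1)]"
    unfolding upt by (simp add: val[simplified] 2[simplified] 3[simplified] 4 5 alt_coeff_def)
qed

lemma coxeter_number_finite_type: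
  assumes "(b, c, h) \<in> {(0, 0, 2), (1, 1, 3), (1, 2, 4), (2, 1, 4), (1, 3, 6), (3, 1, 6)}"
  shows "coxeter_number b c = h"
proof (rule coxeter_number_eqI)
  show "((simple_refl b c 1 \<circ> simple_refl b c 2) ^^ h) (1, 0) = (1, 0)"
    "((simple_refl b c 1 \<circ> simple_refl b c 2) ^^ h) (0, 1) = (0, 1)"
    using assms(1) by (auto simp: simple_refl_1[simplified] simple_refl_2 funpow_small)
  fix k assume k: "k dvd h" "k \<noteq> h"
  have "0 < h" "h \<le> 6"
    using assms by auto
  then have "0 < k" "k < 6"
    using k dvd_imp_le[OF k(1)] dvd_pos_nat[OF _ k(1)] by auto
  then have "k \<in> {1, 2, 3, 4, 5}"
    by auto
  then show "((simple_refl b c 1 \<circ> simple_refl b c 2) ^^ k) (1, 0) \<noteq> (1, 0)"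
    using assms k by (auto simp: simple_refl_1[simplified] simple_refl_2 funpow_small)
qed

lemma finite_type_data:
  assumes "(b, c, h) \<in> {(0, 0, 2), (1, 1, 3), (1, 2, 4), (2, 1, 4), (1, 3, 6), (3, 1, 6)}"
  defines "F \<equiv> root1 b c ` {..<h} \<union> (\<lambda>m. - root1 b c m) ` {..<h}"
  shows "\<And>m. m < h \<Longrightarrow> nonneg (root1 b c m)" and "inj_on (root1 b c) {..<h}"
    and "\<And>v. v \<in> F \<Longrightarrow> simple_refl b c 1 v \<in> F" and "\<And>v. v \<in> F \<Longrightarrow> simple_refl b c 2 v \<in> F"
    and "(1, 0) \<in> F" and "(0, 1) \<in> F" and "(0, 0) \<notin> F"
proof -
  define L where "L = map (root1 b c) [0..<h]"
  have F: "F = set L \<union> uminus ` set L"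
    by (simp add: F_def L_def atLeast0LessThan image_image)
  have L: "distinct L \<and> (\<forall>v\<in>set L. nonneg v) \<and>
      (\<forall>v\<in>F. simple_refl b c 1 v \<in> F \<and> simple_refl b c 2 v \<in> F) \<and>
      (1, 0) \<in> F \<and> (0, 1) \<in> F \<and> (0, 0) \<notin> F"
    using assms(1) unfolding F
    by (elim insertE emptyE)
      (simp_all add: L_def root1_list[simplified] nonneg_def simple_refl_1[simplified] simple_refl_2)
  then show "inj_on (root1 b c) {..<h}"
    by (simp add: L_def distinct_map atLeast0LessThan)
  show "nonneg (root1 b c m)" if "m < h" for m
    using L that by (simp add: L_def)
  show "\<And>v. v \<in> F \<Longrightarrow> simple_refl b c 1 v \<in> F" "\<And>v. v \<in> F \<Longrightarrow> simple_refl b c 2 v \<in> F"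
    "(1, 0) \<in> F" "(0, 1) \<in> F" "(0, 0) \<notin> F"
    using L by blast+
qed

subsection \<open>Denominators of cluster variables\<close>

theorem theorem6p1:
  fixes b c :: nat
    and q r :: "int \<Rightarrow> 'p::torsion_free_ab_group_mult"
    and y :: "int \<Rightarrow> 'p rat2"
    and \<delta> :: "int \<Rightarrow> int \<times> int"
  assumes bc: "(0 < b \<and> 0 < c) \<or> (b = 0 \<and> c = 0)"
    and coeff_odd: "\<And>m. odd m \<Longrightarrow> q (m - 1) * q (m + 1) * r m ^ c = r (m - 1) * r (m + 1)"
    and coeff_even: "\<And>m. even m \<Longrightarrow> q (m - 1) * q (m + 1) * r m ^ b = r (m - 1) * r (m + 1)"
    and y_1: "y 1 = fvar1"
    and y_2: "y 2 = fvar2"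
    and exchange_odd: "\<And>m. odd m \<Longrightarrow>
      y (m - 1) * y (m + 1) = const_P (q m) * y m ^ b + const_P (r m)"
    and exchange_even: "\<And>m. even m \<Longrightarrow>
      y (m - 1) * y (m + 1) = const_P (q m) * y m ^ c + const_P (r m)"
    and delta: "\<And>m. \<delta> m = denom_vector (y m)"
  shows "(\<forall>m m'. \<delta> m = \<delta> m' \<longrightarrow> y m / y m' \<in> range const_P)
    \<and> range \<delta> = {- simple_root 1, - simple_root 2} \<union> pos_real_roots b c
    \<and> (4 \<le> b * c \<longrightarrow>
        (\<forall>m::nat. \<delta> (int m + 3) = w1 b c m (simple_root (ang (m + 1)))
                \<and> \<delta> (- int m) = w2 b c m (simple_root (ang (m + 2))))
        \<and> inj (\<lambda>m. denom_monomial (\<delta> m) :: 'p rat2))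
    \<and> (b * c \<le> 3 \<longrightarrow>
        (\<forall>m::nat. m < coxeter_number b c \<longrightarrow>
                \<delta> (int m + 3) = w1 b c m (simple_root (ang (m + 1))))
        \<and> (\<forall>m. \<delta> (m + int (coxeter_number b c) + 2) = \<delta> m)
        \<and> (\<forall>m. (denom_monomial (\<delta> (m + int (coxeter_number b c) + 2)) :: 'p rat2)
                = denom_monomial (\<delta> m))
        \<and> (\<forall>m. y (m + int (coxeter_number b c) + 2) / y m \<in> range const_P))"
proof -
  have exchange: "y (m - 1) * y (m + 1) = const_P (q m) * y m ^ alt_exp b c m + const_P (r m)" for m
    using exchange_odd[of m] exchange_even[of m] by (simp add: alt_exp_def)
  \<comment> \<open>Coefficients have exponent 0, which is the 0 in the maximum.\<close>
  have trop_rhs: "has_trop (const_P (q m) * y m ^ alt_exp b c m + const_P (r m))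
      (int (alt_exp b c m) * max (fst d) 0, int (alt_exp b c m) * max (snd d) 0)"
    if "has_trop (y m) d" for m d
    using has_trop_add[OF has_trop_mult[OF has_trop_const has_trop_power[OF that]] has_trop_const]
    by (simp add: max_mult_distrib_left)
  have ex_trop: "(\<exists>d. has_trop (y m) d) \<and> (\<exists>d. has_trop (y (m + 1)) d)" for m
  proof (induction m rule: int_induct[where k = 1])
    case base
    show ?case using has_trop_fvar by (auto simp: y_1 y_2)
  next
    case (step1 i)
    then obtain d e where d: "has_trop (y i) d" and e: "has_trop (y (i + 1)) e" by blast
    have "y (i + 1 + 1) = (const_P (q (i + 1)) * y (i + 1) ^ alt_exp b c (i + 1) + const_P (r (i + 1))) / y i"
      using exchange[of "i + 1"] has_trop_nonzero[OF d] by (simp add: field_simps)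
    with has_trop_divide[OF trop_rhs[OF e] d] e show ?case
      by metis
  next
    case (step2 i)
    then obtain d e where d: "has_trop (y i) d" and e: "has_trop (y (i + 1)) e" by blast
    have "y (i - 1) = (const_P (q i) * y i ^ alt_exp b c i + const_P (r i)) / y (i + 1)"
      using exchange[of i] has_trop_nonzero[OF e] by (simp add: field_simps)
    with has_trop_divide[OF trop_rhs[OF d] e] d show ?case
      by (metis diff_add_cancel)
  qed
  interpret exchange_pattern b c "range const_P" "\<lambda>m. const_P (q m)" "\<lambda>m. const_P (r m)" y
  proof
    show "y m \<noteq> 0" for m
      using ex_trop has_trop_nonzero by blast
    show "const_P (q (m - 1)) * const_P (q (m + 1)) * const_P (r m) ^ alt_exp b c (m + 1)
        = const_P (r (m - 1)) * const_P (r (m + 1))" for m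
      using coeff_odd[of m] coeff_even[of m]
      by (simp add: alt_exp_def flip: const_P_mult const_P_power)
    show "1 \<in> range const_P"
      by (metis const_P_1 rangeI)
    show "u * v \<in> range const_P" if "u \<in> range const_P" "v \<in> range const_P" for u v :: "'p rat2"
      using that by (auto simp flip: const_P_mult)
    show "1 / u \<in> range const_P" if "u \<in> range const_P" for u :: "'p rat2"
      using that by (auto simp flip: const_P_inverse)
  qed (use bc exchange in auto)
  have const_laurent: "range const_P \<subseteq> laurent"
    by (auto simp: const_P_def laurent_to_fract)
  have laurent_power: "f ^ n \<in> laurent" if "f \<in> laurent" for f :: "'p rat2" and n
    using that by (induction n) (use laurent_to_fract[of 1] in \<open>simp_all add: laurent_mult\<close>)
  have fvar: "fvar1 \<in> laurent" "fvar2 \<in> laurent"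
    "1 / fvar1 \<in> laurent" "1 / fvar2 \<in> laurent"
    using laurent_inverse_monomial[of "(1, 0)"] laurent_inverse_monomial[of "(0, 1)"]
    by (simp_all add: fvar1_def fvar2_def laurent_to_fract denom_monomial_def)
  have laurent: "y m \<in> laurent" for m
  proof (rule all_in_ring[OF laurent_add laurent_mult _ const_laurent])
    show "- f \<in> laurent" if "f \<in> laurent" for f :: "'p rat2"
      using laurent_diff[OF laurent_to_fract[of 0] that] by simp
    have rhs: "const_P (q m) * y m ^ alt_exp b c m + const_P (r m) \<in> laurent" if "y m \<in> laurent" for m
      using const_laurent that by (intro laurent_add laurent_mult laurent_power) auto
    show y12: "y 1 \<in> laurent" "y 2 \<in> laurent"
      by (simp_all add: y_1 y_2 fvar)
    have "y 0 = (const_P (q 1) * y 1 ^ alt_exp b c 1 + const_P (r 1)) * (1 / fvar2)"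
      using exchange[of 1] by (simp add: y_2 field_simps)
    then show "y 0 \<in> laurent"
      using laurent_mult[OF rhs[OF y12(1)] fvar(4)] by simp
    have "y 3 = (const_P (q 2) * y 2 ^ alt_exp b c 2 + const_P (r 2)) * (1 / fvar1)"
      using exchange[of 2] by (simp add: y_1 field_simps)
    then show "y 3 \<in> laurent"
      using laurent_mult[OF rhs[OF y12(2)] fvar(3)] by simp
  qed
  \<comment> \<open>From here \<open>\<delta>\<close>, given by a definite description, is the
    tropical exponent and can be computed by tropical arithmetic.\<close>
  have trop: "has_trop (y m) (\<delta> m)" for m
    using ex_trop[of m] denom_vector_eq(2)[OF laurent] by (auto simp: delta)
  interpret denominator_recursion b c \<delta>
  proof
    have "- simple_root 1 = \<delta> 1" "- simple_root 2 = \<delta> 2"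
      using has_trop_fvar trop[of 1] trop[of 2] has_trop_unique unfolding y_1 y_2 by blast+
    then show "\<delta> 1 = (- 1, 0)" "\<delta> 2 = (0, - 1)"
      by simp_all
    fix m :: int
    have "\<delta> (m - 1) + \<delta> (m + 1) =
        (int (alt_exp b c m) * max (fst (\<delta> m)) 0, int (alt_exp b c m) * max (snd (\<delta> m)) 0)"
      by (rule has_trop_unique[OF has_trop_mult[OF trop trop]]) (simp only: exchange trop_rhs trop)
    then show "fst (\<delta> (m - 1)) + fst (\<delta> (m + 1)) = int (if odd m then b else c) * max (fst (\<delta> m)) 0"
      "snd (\<delta> (m - 1)) + snd (\<delta> (m + 1)) = int (if odd m then b else c) * max (snd (\<delta> m)) 0"
      by (simp_all add: prod_eq_iff alt_exp_def)
  qed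
  show ?thesis
  proof (cases "4 \<le> b * c")
    case True
    have "inj \<delta>"
      by (rule infinite_inj[OF True])
    \<comment> \<open>The reduced numerator 1 on both sides makes this a case of uniqueness of
      exponents.\<close>
    moreover have "inj (denom_monomial :: int \<times> int \<Rightarrow> 'p rat2)"
    proof (rule injI)
      fix d e :: "int \<times> int"
      assume "denom_monomial d = (denom_monomial e :: 'p rat2)"
      then show "d = e"
        using edge_positive_not_dvd[OF edge_positive_1]
        by (intro denom_monomial_eqD[of "1 :: 'p pol2" d 1 e]) simp_all
    qed
    ultimately have "inj (\<lambda>m. denom_monomial (\<delta> m) :: 'p rat2)"
      unfolding inj_def by metis
    moreover have "y m / y m' \<in> range const_P" if "\<delta> m = \<delta> m'" for m m'
      using injD[OF \<open>inj \<delta>\<close> that] U_1 by simp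
    ultimately show ?thesis
      using True infinite_range[OF True] infinite_case[OF True]
      by (simp add: root1_def root2_def)
  next
    case False
    then have "b * c \<le> 3" by simp
    then obtain h :: nat where h: "(b, c, h) \<in> {(0, 0, 2), (1, 1, 3), (1, 2, 4), (2, 1, 4), (1, 3, 6), (3, 1, 6)}"
      by (rule finite_type_cases[OF bc]) (use that in blast)+
    note data = finite_type_data[OF h]
    have period: "y (m + int h + 2) / y m \<in> range const_P" for m
      by (rule finite_type_periodic[OF h])
    \<comment> \<open>Periodicity passes from variables to vectors, since a coefficient has tropical
      exponent 0.\<close>
    have delta_period: "\<delta> (m + int h + 2) = \<delta> m" for m
    proof -
      obtain p where "y (m + int h + 2) = const_P p * y m"
        using period[of m] by (auto simp: field_simps)
      then show ?thesis
        using has_trop_unique[OF trop[of "m + int h + 2"]] has_trop_mult[OF has_trop_const trop[of m], of p]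
        by simp
    qed
    have range: "range \<delta> = {- simple_root 1, - simple_root 2} \<union> pos_real_roots b c"
      by (rule finite_case(1)[OF data(1,2) refl data(3-7) delta_period])
    have mod: "m mod (int h + 2) = n mod (int h + 2)" if "\<delta> m = \<delta> n" for m n
      by (rule finite_case(2)[OF data(1,2) refl data(3-7) delta_period that])
    have "y m / y m' \<in> range const_P" if "\<delta> m = \<delta> m'" for m m'
      by (rule periodic_mod[of "int h + 2", OF _ mod[OF that]]) (use period in \<open>simp add: add.assoc\<close>)
    then show ?thesis
      using False range delta_root1[OF data(1)] delta_period period
      by (simp add: coxeter_number_finite_type[OF h] root1_def)
  qed
qed

end
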